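(* Let $T$ be a consistent RE theory, $n\ge1$, and $I:{\sf Num}\unlhd T$ an interpretation such that the pairing function $J_2$ is strongly definable in $T$ w.r.t. $I$. If $T$ is effectively $n$-Rosser w.r.t. $I$, then $T$ is effectively $(n+1)$-Rosser w.r.t. $I$.
   Context: $J_2:\mathbb N^2\to\mathbb N$ is a fixed recursive pairing function (bijection). A fixed Gödel numbering of formulas is used. ${\sf Num}$ is the theory in the language $\{\mathbf 0,\mathbf S\}$ with axioms $\overline m\neq\overline n$ for $m\neq n$, where $\overline 0=\mathbf 0$, $\overline{k+1}=\mathbf S\overline k$. An interpretation $I:{\sf Num}\unlhd T$ is a translation of the language of ${\sf Num}$ into that of $T$ such that $T$ proves totality of translated function symbols on the domain, the translations of all theorems of ${\sf Num}$ and of the equality axioms; $\overline a^I$ is the $I$-translation of $\overline a$. $J_2$ is strongly definable in $T$ w.r.t. $I$ if there is a formula $\theta(x,y,z)$ with $T\vdash\forall z[\theta(\overline a^I,\overline b^I,z)\leftrightarrow z=\overline{J_2(a,b)}^I]$ for all $a,b$. $\langle R^k_i\rangle$ is an acceptable enumeration of $k$-ary RE relations. A formula $\phi(x_1,\dots,x_k)$ with exactly $k$ free variables strongly separates $M_1$ from $M_2$ w.r.t. $I$ if $\vec a\in M_1\Rightarrow T\vdash\phi(\overline{a_1}^I,\dots,\overline{a_k}^I)$ and $\vec a\in M_2\Rightarrow T\vdash\neg\phi(\overline{a_1}^I,\dots,\overline{a_k}^I)$. $T$ is effectively $k$-Rosser w.r.t. $I$ if there is a recursive $f$ such that for all $i,j$,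 $f(i,j)$ is the code of a formula with exactly $k$ free variables strongly separating $R^k_i\setminus R^k_j$ from $R^k_j\setminus R^k_i$ w.r.t. $I$. *)

theory Defs
  imports "HOL-Library.Nat_Bijection"
begin

section \<open>Partial recursive functions and RE relations\<close>

text \<open>Kleene's mu-recursive functions. Tuples of natural numbers are lists of the
  appropriate length; primitive recursion and search act on the first argument.\<close>

datatype recf =
    Zero
  | Succ
  | Proj nat
  | Comp recf "recf list"
  | PrimRec recf recf
  | Mu recf

inductive eval :: "recf \<Rightarrow> nat list \<Rightarrow> nat \<Rightarrow> bool" where
  Zero: "eval Zero xs 0"
| Succ: "eval Succ [x] (Suc x)"
| Proj: "i < length xs \<Longrightarrow> eval (Proj i) xs (xs ! i)"
| Comp: "list_all2 (\<lambda>g y. eval g xs y) gs ys \<Longrightarrow> eval f ys z \<Longrightarrow> eval (Comp f gs) xs z"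
| PrimRec_0: "eval f xs y \<Longrightarrow> eval (PrimRec f g) (0 # xs) y"
| PrimRec_Suc: "eval (PrimRec f g) (m # xs) r \<Longrightarrow> eval g (m # r # xs) y
    \<Longrightarrow> eval (PrimRec f g) (Suc m # xs) y"
| Mu: "eval f (m # xs) 0 \<Longrightarrow> \<forall>i<m. \<exists>y. eval f (i # xs) (Suc y) \<Longrightarrow> eval (Mu f) xs m"

definition recursive :: "nat \<Rightarrow> (nat list \<Rightarrow> nat) \<Rightarrow> bool" where
  "recursive k f \<longleftrightarrow> (\<exists>p. \<forall>xs. length xs = k \<longrightarrow> eval p xs (f xs))"

definition re_rel :: "nat \<Rightarrow> nat list set \<Rightarrow> bool" where
  "re_rel k M \<longleftrightarrow> (\<exists>p. M = {xs. length xs = k \<and> (\<exists>y. eval p xs y)})"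

text \<open>Acceptability in the sense of Rogers: for every arity, \<open>R k\<close> lists exactly the RE
  relations, uniformly (enumeration theorem), and the s-m-n (iteration) theorem holds.\<close>

definition acceptable :: "(nat \<Rightarrow> nat \<Rightarrow> nat list set) \<Rightarrow> bool" where
  "acceptable R \<longleftrightarrow>
     (\<forall>k\<ge>1. range (R k) = {M. re_rel k M}) \<and>
     (\<forall>k\<ge>1. re_rel (Suc k) {i # xs | i xs. xs \<in> R k i}) \<and>
     (\<forall>m\<ge>1. \<forall>k\<ge>1. \<exists>s. recursive (Suc m) s \<and>
        (\<forall>i xs ys. length xs = m \<longrightarrow> length ys = k \<longrightarrow>
           (ys \<in> R k (s (i # xs)) \<longleftrightarrow> xs @ ys \<in> R (m + k) i)))"

definition pairing :: "(nat \<Rightarrow> nat \<Rightarrow> nat) \<Rightarrow> bool" where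
  "pairing J \<longleftrightarrow> recursive 2 (\<lambda>xs. J (xs ! 0) (xs ! 1)) \<and> bij (\<lambda>(x, y). J x y)"


section \<open>First-order logic with identity\<close>

text \<open>Variables are de Bruijn indices. Symbols are numbers; a symbol used with different
  numbers of arguments counts as different symbols, so a language is given by sets of pairs of
  a name and an arity.\<close>

datatype tm = Var nat | Fn nat "tm list"

datatype fm =
    Bot
  | Eq tm tm
  | Rel nat "tm list"
  | Imp fm fm
  | All fm

abbreviation Neg :: "fm \<Rightarrow> fm" where "Neg \<phi> \<equiv> Imp \<phi> Bot"
abbreviation Top :: fm where "Top \<equiv> Neg Bot"
abbreviation And :: "fm \<Rightarrow> fm \<Rightarrow> fm" where "And \<phi> \<psi> \<equiv> Neg (Imp \<phi> (Neg \<psi>))"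
abbreviation Iff :: "fm \<Rightarrow> fm \<Rightarrow> fm" where "Iff \<phi> \<psi> \<equiv> And (Imp \<phi> \<psi>) (Imp \<psi> \<phi>)"
abbreviation Ex :: "fm \<Rightarrow> fm" where "Ex \<phi> \<equiv> Neg (All (Neg \<phi>))"

abbreviation Conj :: "fm list \<Rightarrow> fm" where "Conj \<phi>s \<equiv> foldr And \<phi>s Top"
abbreviation Alls :: "nat \<Rightarrow> fm \<Rightarrow> fm" where "Alls k \<equiv> All ^^ k"
abbreviation Exs :: "nat \<Rightarrow> fm \<Rightarrow> fm" where "Exs k \<equiv> (\<lambda>\<phi>. Ex \<phi>) ^^ k"

record lang =
  funs :: "(nat \<times> nat) set"
  rels :: "(nat \<times> nat) set"

fun wf_tm :: "lang \<Rightarrow> tm \<Rightarrow> bool" where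
  "wf_tm L (Var v) \<longleftrightarrow> True"
| "wf_tm L (Fn f ts) \<longleftrightarrow> (f, length ts) \<in> funs L \<and> (\<forall>t\<in>set ts. wf_tm L t)"

fun wf_fm :: "lang \<Rightarrow> fm \<Rightarrow> bool" where
  "wf_fm L Bot \<longleftrightarrow> True"
| "wf_fm L (Eq s t) \<longleftrightarrow> wf_tm L s \<and> wf_tm L t"
| "wf_fm L (Rel p ts) \<longleftrightarrow> (p, length ts) \<in> rels L \<and> (\<forall>t\<in>set ts. wf_tm L t)"
| "wf_fm L (Imp \<phi> \<psi>) \<longleftrightarrow> wf_fm L \<phi> \<and> wf_fm L \<psi>"
| "wf_fm L (All \<phi>) \<longleftrightarrow> wf_fm L \<phi>"

fun fv_tm :: "tm \<Rightarrow> nat set" where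
  "fv_tm (Var v) = {v}"
| "fv_tm (Fn f ts) = (\<Union>t\<in>set ts. fv_tm t)"

fun fv :: "fm \<Rightarrow> nat set" where
  "fv Bot = {}"
| "fv (Eq s t) = fv_tm s \<union> fv_tm t"
| "fv (Rel p ts) = (\<Union>t\<in>set ts. fv_tm t)"
| "fv (Imp \<phi> \<psi>) = fv \<phi> \<union> fv \<psi>"
| "fv (All \<phi>) = {v. Suc v \<in> fv \<phi>}"

definition sentence :: "lang \<Rightarrow> fm \<Rightarrow> bool" where
  "sentence L \<phi> \<longleftrightarrow> wf_fm L \<phi> \<and> fv \<phi> = {}"

fun subst_tm :: "(nat \<Rightarrow> tm) \<Rightarrow> tm \<Rightarrow> tm" where
  "subst_tm \<sigma> (Var v) = \<sigma> v"
| "subst_tm \<sigma> (Fn f ts) = Fn f (map (subst_tm \<sigma>) ts)"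

fun subst :: "(nat \<Rightarrow> tm) \<Rightarrow> fm \<Rightarrow> fm" where
  "subst \<sigma> Bot = Bot"
| "subst \<sigma> (Eq s t) = Eq (subst_tm \<sigma> s) (subst_tm \<sigma> t)"
| "subst \<sigma> (Rel p ts) = Rel p (map (subst_tm \<sigma>) ts)"
| "subst \<sigma> (Imp \<phi> \<psi>) = Imp (subst \<sigma> \<phi>) (subst \<sigma> \<psi>)"
| "subst \<sigma> (All \<phi>) = All (subst (case_nat (Var 0) (\<lambda>v. subst_tm (\<lambda>w. Var (Suc w)) (\<sigma> v))) \<phi>)"

abbreviation rename :: "(nat \<Rightarrow> nat) \<Rightarrow> fm \<Rightarrow> fm" where
  "rename r \<equiv> subst (\<lambda>v. Var (r v))"

text \<open>\<open>subst1 t \<phi>\<close> replaces variable 0 of \<open>\<phi>\<close> by \<open>t\<close> and lowers the other variables, as needed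
  when the outer quantifier of \<open>All \<phi>\<close> is removed.\<close>

abbreviation subst1 :: "tm \<Rightarrow> fm \<Rightarrow> fm" where
  "subst1 t \<equiv> subst (case_nat t Var)"

text \<open>Classical natural deduction; every formula in a derivation belongs to the language \<open>L\<close>.\<close>

inductive prv :: "lang \<Rightarrow> fm set \<Rightarrow> fm \<Rightarrow> bool" for L :: lang where
  Assm: "\<phi> \<in> \<Gamma> \<Longrightarrow> wf_fm L \<phi> \<Longrightarrow> prv L \<Gamma> \<phi>"
| ImpI: "wf_fm L \<phi> \<Longrightarrow> prv L (insert \<phi> \<Gamma>) \<psi> \<Longrightarrow> prv L \<Gamma> (Imp \<phi> \<psi>)"
| ImpE: "prv L \<Gamma> (Imp \<phi> \<psi>) \<Longrightarrow> prv L \<Gamma> \<phi> \<Longrightarrow> prv L \<Gamma> \<psi>"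
| Classical: "wf_fm L \<phi> \<Longrightarrow> prv L (insert (Neg \<phi>) \<Gamma>) Bot \<Longrightarrow> prv L \<Gamma> \<phi>"
| AllI: "prv L (rename Suc ` \<Gamma>) \<phi> \<Longrightarrow> prv L \<Gamma> (All \<phi>)"
| AllE: "prv L \<Gamma> (All \<phi>) \<Longrightarrow> wf_tm L t \<Longrightarrow> prv L \<Gamma> (subst1 t \<phi>)"
| Refl: "wf_tm L t \<Longrightarrow> prv L \<Gamma> (Eq t t)"
| Leibniz: "prv L \<Gamma> (Eq s t) \<Longrightarrow> prv L \<Gamma> (subst1 s \<phi>) \<Longrightarrow> prv L \<Gamma> (subst1 t \<phi>)"

fun code_tm :: "tm \<Rightarrow> nat" where
  "code_tm (Var v) = prod_encode (0, v)"
| "code_tm (Fn f ts) = prod_encode (Suc f, list_encode (map code_tm ts))"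

fun code :: "fm \<Rightarrow> nat" where
  "code Bot = prod_encode (0, 0)"
| "code (Eq s t) = prod_encode (1, prod_encode (code_tm s, code_tm t))"
| "code (Rel p ts) = prod_encode (2, prod_encode (p, list_encode (map code_tm ts)))"
| "code (Imp \<phi> \<psi>) = prod_encode (3, prod_encode (code \<phi>, code \<psi>))"
| "code (All \<phi>) = prod_encode (4, code \<phi>)"

lemma code_tm_inject: "code_tm s = code_tm t \<longleftrightarrow> s = t"
proof
  show "code_tm s = code_tm t \<Longrightarrow> s = t"
  proof (induction s arbitrary: t)
    case (Var v)
    then show ?case by (cases t) auto
  next
    case (Fn f ts)
    then obtain us where t: "t = Fn f us" and m: "map code_tm ts = map code_tm us"
      by (cases t) (auto simp: list_encode_eq)
    have "ts = us"
    proof (rule nth_equalityI)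
      show "length ts = length us" using m by (rule map_eq_imp_length_eq)
    next
      fix i assume i: "i < length ts"
      have len: "length ts = length us" using m by (rule map_eq_imp_length_eq)
      have "code_tm (ts ! i) = code_tm (us ! i)"
        using i len arg_cong[OF m, of "\<lambda>l. l ! i"] by simp
      then show "ts ! i = us ! i" using Fn.IH i by simp
    qed
    then show ?case using t by simp
  qed
qed simp

lemma code_inject: "code \<phi> = code \<psi> \<longleftrightarrow> \<phi> = \<psi>"
proof
  have inj: "inj code_tm" by (rule injI) (simp add: code_tm_inject)
  show "code \<phi> = code \<psi> \<Longrightarrow> \<phi> = \<psi>"
    by (induction \<phi> arbitrary: \<psi>; case_tac \<psi>)
      (auto simp: code_tm_inject list_encode_eq inj_map_eq_map[OF inj])
qed simp

text \<open>A theory is presented by a set \<open>T\<close> of sentences; it is RE if its set of theorems is.\<close>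

definition is_theory :: "lang \<Rightarrow> fm set \<Rightarrow> bool" where
  "is_theory L T \<longleftrightarrow> (\<forall>\<phi>\<in>T. sentence L \<phi>)"

definition consistent :: "lang \<Rightarrow> fm set \<Rightarrow> bool" where
  "consistent L T \<longleftrightarrow> \<not> prv L T Bot"

definition re_theory :: "lang \<Rightarrow> fm set \<Rightarrow> bool" where
  "re_theory L T \<longleftrightarrow> re_rel 1 {[code \<phi>] | \<phi>. sentence L \<phi> \<and> prv L T \<phi>}"


section \<open>Interpretations\<close>

text \<open>Identity and domain may be translated by arbitrary formulas. The formulas for a symbol of
  arity \<open>k\<close> have the arguments as variables \<open>0,\<dots>,k-1\<close>; for a function symbol the value is
  variable \<open>k\<close>.\<close>

record transl =
  t_dom :: fm
  t_eq :: fm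
  t_fun :: "nat \<Rightarrow> nat \<Rightarrow> fm"
  t_rel :: "nat \<Rightarrow> nat \<Rightarrow> fm"

definition is_transl :: "lang \<Rightarrow> lang \<Rightarrow> transl \<Rightarrow> bool" where
  "is_transl K L I \<longleftrightarrow>
     wf_fm L (t_dom I) \<and> fv (t_dom I) \<subseteq> {0} \<and>
     wf_fm L (t_eq I) \<and> fv (t_eq I) \<subseteq> {0, 1} \<and>
     (\<forall>(f, k)\<in>funs K. wf_fm L (t_fun I f k) \<and> fv (t_fun I f k) \<subseteq> {..k}) \<and>
     (\<forall>(p, k)\<in>rels K. wf_fm L (t_rel I p k) \<and> fv (t_rel I p k) \<subseteq> {..<k})"

text \<open>A term translates not to a term but to a formula defining its value. Such a formula has
  the value as variable 0, and variable \<open>v\<close> of the context as variable \<open>Suc v\<close>.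
  \<open>vsubst I gs \<phi>\<close> substitutes values defined by \<open>gs\<close> for the first \<open>k = length gs\<close> variables of
  \<open>\<phi>\<close>, lowering the others by \<open>k\<close>: it is
  \<open>\<exists>x\<^sub>0 \<dots> x\<^sub>k\<^sub>-\<^sub>1. (\<And>i<k. \<delta>(x\<^sub>i) \<and> g\<^sub>i(x\<^sub>i)) \<and> \<phi>(x\<^sub>0, \<dots>, x\<^sub>k\<^sub>-\<^sub>1, \<dots>)\<close>.\<close>

definition vsubst :: "transl \<Rightarrow> fm list \<Rightarrow> fm \<Rightarrow> fm" where
  "vsubst I gs \<phi> = (let k = length gs in
     Exs k (And
       (Conj (map (\<lambda>i. And (rename (\<lambda>_. i) (t_dom I))
                           (rename (case_nat i (\<lambda>v. v + k)) (gs ! i))) [0..<k]))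
       \<phi>))"

text \<open>The clause for variables uses the identity of the target theory, so that
  substituting a variable by \<open>vsubst\<close> amounts to ordinary substitution. In the clause for
  compound terms the variables of the context are raised once more, past the value of
  the whole term.\<close>

fun graph :: "transl \<Rightarrow> tm \<Rightarrow> fm" where
  "graph I (Var v) = Eq (Var 0) (Var (Suc v))"
| "graph I (Fn f ts) =
     vsubst I (map (\<lambda>t. rename (case_nat 0 (\<lambda>v. Suc (Suc v))) (graph I t)) ts)
       (t_fun I f (length ts))"

text \<open>Equations are unnested to equations between variables and equations \<open>F(xs) = y\<close>; the
  latter become the formula translating \<open>F\<close>, the former the formula translating identity.\<close>

fun tr :: "transl \<Rightarrow> fm \<Rightarrow> fm" where
  "tr I Bot = Bot"
| "tr I (Eq (Var v) (Var w)) = rename (case_nat v (\<lambda>_. w)) (t_eq I)"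
| "tr I (Eq s t) = Ex (And (t_dom I) (And (graph I s) (graph I t)))"
| "tr I (Rel p ts) = vsubst I (map (graph I) ts) (t_rel I p (length ts))"
| "tr I (Imp \<phi> \<psi>) = Imp (tr I \<phi>) (tr I \<psi>)"
| "tr I (All \<phi>) = All (Imp (t_dom I) (tr I \<phi>))"

definition total_fun :: "transl \<Rightarrow> nat \<Rightarrow> nat \<Rightarrow> fm" where
  "total_fun I f k =
     Alls k (Imp (Conj (map (\<lambda>i. rename (\<lambda>_. i) (t_dom I)) [0..<k]))
       (Ex (And (t_dom I) (rename (\<lambda>v. if v < k then Suc v else 0) (t_fun I f k)))))"

text \<open>The equality axioms of the language \<open>K\<close>, as universal sentences.\<close>

definition eq_axioms :: "lang \<Rightarrow> fm set" where
  "eq_axioms K =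
     {All (Eq (Var 0) (Var 0)),
      Alls 2 (Imp (Eq (Var 0) (Var 1)) (Eq (Var 1) (Var 0))),
      Alls 3 (Imp (Eq (Var 0) (Var 1)) (Imp (Eq (Var 1) (Var 2)) (Eq (Var 0) (Var 2))))} \<union>
     {Alls (2 * k) (Imp (Conj (map (\<lambda>i. Eq (Var i) (Var (k + i))) [0..<k]))
        (Eq (Fn f (map Var [0..<k])) (Fn f (map Var [k..<2 * k])))) | f k. (f, k) \<in> funs K} \<union>
     {Alls (2 * k) (Imp (Conj (map (\<lambda>i. Eq (Var i) (Var (k + i))) [0..<k]))
        (Imp (Rel p (map Var [0..<k])) (Rel p (map Var [k..<2 * k])))) | p k. (p, k) \<in> rels K}"

definition interpretation_of :: "lang \<Rightarrow> fm set \<Rightarrow> lang \<Rightarrow> fm set \<Rightarrow> transl \<Rightarrow> bool" where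
  "interpretation_of K U L T I \<longleftrightarrow>
     is_transl K L I \<and>
     (\<forall>(f, k)\<in>funs K. prv L T (total_fun I f k)) \<and>
     (\<forall>\<phi>. sentence K \<phi> \<and> prv K U \<phi> \<longrightarrow> prv L T (tr I \<phi>)) \<and>
     (\<forall>\<phi>\<in>eq_axioms K. prv L T (tr I \<phi>))"


section \<open>The theory Num and Rosser theories\<close>

definition num_lang :: lang where
  "num_lang = \<lparr>funs = {(0, 0), (1, 1)}, rels = {}\<rparr>"

primrec num :: "nat \<Rightarrow> tm" where
  "num 0 = Fn 0 []"
| "num (Suc n) = Fn 1 [num n]"

definition Num :: "fm set" where
  "Num = {Neg (Eq (num m) (num n)) | m n. m \<noteq> n}"

abbreviation interprets_Num :: "lang \<Rightarrow> fm set \<Rightarrow> transl \<Rightarrow> bool" where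
  "interprets_Num L T I \<equiv> interpretation_of num_lang Num L T I"

text \<open>\<open>num_inst I [a\<^sub>0, \<dots>, a\<^sub>k\<^sub>-\<^sub>1] \<phi>\<close> is \<open>\<phi>\<close> with the translated numerals of the \<open>a\<^sub>i\<close> substituted
  for its first \<open>k\<close> variables; the numerals are eliminated in front of the whole of \<open>\<phi>\<close>. In
  particular \<open>Neg (num_inst I as \<phi>)\<close> is the negation of an instance, not an instance of a
  negation; the two can differ if \<open>I\<close> does not translate identity by identity.\<close>

definition num_inst :: "transl \<Rightarrow> nat list \<Rightarrow> fm \<Rightarrow> fm" where
  "num_inst I as \<phi> = vsubst I (map (\<lambda>a. graph I (num a)) as) \<phi>"

text \<open>In \<open>\<theta>\<close>, the variables 0, 1, 2 stand for \<open>x, y, z\<close>. Once \<open>x\<close> and \<open>y\<close> are instantiated, \<open>z\<close>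
  has become variable 0; on the right, the numeral is substituted for \<open>x\<close> in \<open>z = x\<close>.\<close>

definition strongly_definable2 ::
    "lang \<Rightarrow> fm set \<Rightarrow> transl \<Rightarrow> (nat \<Rightarrow> nat \<Rightarrow> nat) \<Rightarrow> bool" where
  "strongly_definable2 L T I J \<longleftrightarrow>
     (\<exists>\<theta>. wf_fm L \<theta> \<and> fv \<theta> \<subseteq> {0, 1, 2} \<and>
       (\<forall>a b. prv L T (All (Iff (num_inst I [a, b] \<theta>)
                                (num_inst I [J a b] (Eq (Var 1) (Var 0)))))))"

definition strongly_separates ::
    "lang \<Rightarrow> fm set \<Rightarrow> transl \<Rightarrow> fm \<Rightarrow> nat list set \<Rightarrow> nat list set \<Rightarrow> bool" where
  "strongly_separates L T I \<phi> M\<^sub>1 M\<^sub>2 \<longleftrightarrow>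
     (\<forall>as\<in>M\<^sub>1. prv L T (num_inst I as \<phi>)) \<and>
     (\<forall>as\<in>M\<^sub>2. prv L T (Neg (num_inst I as \<phi>)))"

definition effectively_Rosser ::
    "(nat \<Rightarrow> nat \<Rightarrow> nat list set) \<Rightarrow> nat \<Rightarrow> lang \<Rightarrow> fm set \<Rightarrow> transl \<Rightarrow> bool" where
  "effectively_Rosser R k L T I \<longleftrightarrow>
     (\<exists>f. recursive 2 f \<and>
       (\<forall>i j. \<exists>\<phi>. f [i, j] = code \<phi> \<and> wf_fm L \<phi> \<and> fv \<phi> = {..<k} \<and>
          strongly_separates L T I \<phi> (R k i - R k j) (R k j - R k i)))"

end

theory Submission
  imports Defs
begin

text \<open>Pairing the first two coordinates turns an \<open>(n+1)\<close>-ary RE relation into an \<open>n\<close>-ary one, and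
  by the s-m-n theorem an index of the latter is a recursive function \<open>h\<close> of an index of the
  former. If \<open>\<phi>(z\<^sub>0, \<dots>)\<close> strongly separates the \<open>n\<close>-ary relations with indices \<open>h i\<close> and \<open>h j\<close>, then
  \<open>\<psi>(x\<^sub>0, x\<^sub>1, \<dots>) = \<exists>z\<^sub>0. \<theta>(x\<^sub>0, x\<^sub>1, z\<^sub>0) \<and> \<phi>(z\<^sub>0, \<dots>)\<close> strongly separates the relations with indices
  \<open>i\<close> and \<open>j\<close>. Numerals need not denote unique elements of \<open>T\<close>, but strong definability makes
  \<open>\<theta>(a, b, z)\<close> equivalent to \<open>z\<close> being a numeral of \<open>J\<^sub>2 a b\<close>, so \<open>T\<close> proves the instance of \<open>\<psi>\<close> at
  \<open>(a, b, \<dots>)\<close> equivalent to the instance of \<open>\<phi>\<close> at \<open>(J\<^sub>2 a b, \<dots>)\<close>, uniqueness or not.\<close>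

section \<open>Recursive functions\<close>

text \<open>Needed to read a halting composition backwards: its intermediate values can only be
  those of the inner functions. For a search, a smaller competing result would give the body both
  the value zero and a successor value.\<close>

lemma eval_deterministic: "eval p xs y \<Longrightarrow> eval p xs z \<Longrightarrow> y = z"
proof (induction arbitrary: z rule: eval.induct)
  case (Comp xs gs ys f y)
  from Comp.prems obtain ys' where
    ys': "list_all2 (\<lambda>g y. eval g xs y) gs ys'" "eval f ys' z"
    by (cases rule: eval.cases) auto
  have "ys = ys'"
    using Comp.IH(1) ys'(1) by (auto simp: list_all2_conv_all_nth intro!: nth_equalityI)
  then show ?case using Comp.IH(2) ys'(2) by simp
next
  case (Mu f m xs)
  from Mu.prems have z: "eval f (z # xs) 0" "\<forall>i<z. \<exists>y. eval f (i # xs) (Suc y)"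
    by (cases rule: eval.cases; auto)+
  show ?case
  proof (rule linorder_cases[of m z])
    assume "m < z"
    then show ?thesis using z(2) Mu.IH(1) by (metis nat.distinct(1))
  next
    assume "z < m"
    then show ?thesis using z(1) Mu.IH(2) by (metis nat.distinct(1))
  qed
next
  case (PrimRec_Suc f g m xs r y)
  from PrimRec_Suc.prems show ?case
    by (cases rule: eval.cases) (use PrimRec_Suc.IH in blast)
next
  case (Zero xs)
  then show ?case by (cases rule: eval.cases) auto
next
  case (Succ x)
  then show ?case by (cases rule: eval.cases) auto
next
  case (Proj i xs)
  from Proj.prems show ?case by (cases rule: eval.cases) auto
next
  case (PrimRec_0 f xs y g)
  from PrimRec_0.prems show ?case by (cases rule: eval.cases) (use PrimRec_0.IH in auto)
qed

section \<open>Closure properties of recursive functions\<close>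

lemma recursive_nth: "i < k \<Longrightarrow> recursive k (\<lambda>xs. xs ! i)"
  unfolding recursive_def using eval.Proj by blast

lemma eval_Comp_map:
  "(\<And>f. f \<in> set fs \<Longrightarrow> eval (P f) xs (f xs)) \<Longrightarrow> eval p (map (\<lambda>f. f xs) fs) z
    \<Longrightarrow> eval (Comp p (map P fs)) xs z"
  by (rule eval.Comp) (auto simp: list_all2_conv_all_nth)

lemma recursive_comp:
  assumes "recursive (length fs) g" "\<And>f. f \<in> set fs \<Longrightarrow> recursive k f"
  shows "recursive k (\<lambda>xs. g (map (\<lambda>f. f xs) fs))"
proof -
  from assms(1) obtain p where p: "\<And>xs. length xs = length fs \<Longrightarrow> eval p xs (g xs)"
    unfolding recursive_def by blast
  from assms(2) obtain P where "\<And>f xs. f \<in> set fs \<Longrightarrow> length xs = k \<Longrightarrow> eval (P f) xs (f xs)"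
    unfolding recursive_def by metis
  with p show ?thesis
    unfolding recursive_def by (intro exI[of _ "Comp p (map P fs)"] allI impI eval_Comp_map) auto
qed

lemma recursive_comp1:
  "recursive 1 (\<lambda>xs. F (xs ! 0)) \<Longrightarrow> recursive k f \<Longrightarrow> recursive k (\<lambda>xs. F (f xs))"
  using recursive_comp[of "[f]" "\<lambda>xs. F (xs ! 0)" k] by simp

lemma recursive_comp2:
  "recursive 2 (\<lambda>xs. F (xs ! 0) (xs ! 1)) \<Longrightarrow> recursive k f \<Longrightarrow> recursive k g
    \<Longrightarrow> recursive k (\<lambda>xs. F (f xs) (g xs))"
  using recursive_comp[of "[f, g]" "\<lambda>xs. F (xs ! 0) (xs ! 1)" k] by (auto simp: numeral_2_eq_2)

lemma recursive_Suc: "recursive k f \<Longrightarrow> recursive k (\<lambda>xs. Suc (f xs))"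
proof (rule recursive_comp1[of Suc])
  have "eval Succ xs (Suc (xs ! 0))" if "length xs = 1" for xs
    using that eval.Succ[of "xs ! 0"] by (cases xs) auto
  then show "recursive 1 (\<lambda>xs. Suc (xs ! 0))" unfolding recursive_def by blast
qed

lemma recursive_const: "recursive k (\<lambda>_. c)"
proof (induction c)
  case 0
  then show ?case unfolding recursive_def using eval.Zero by blast
qed (rule recursive_Suc)

text \<open>\<open>h\<close> is given beforehand and only its recursion equations are checked, so a
  function of HOL is shown recursive from equations it is known to satisfy.\<close>

lemma recursive_primrec:
  assumes f: "recursive k f" and g: "recursive (Suc (Suc k)) g"
    and h0: "\<And>xs. length xs = k \<Longrightarrow> h (0 # xs) = f xs"
    and hS: "\<And>m xs. length xs = k \<Longrightarrow> h (Suc m # xs) = g (m # h (m # xs) # xs)"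
  shows "recursive (Suc k) h"
proof -
  from f obtain p where p: "\<And>xs. length xs = k \<Longrightarrow> eval p xs (f xs)"
    unfolding recursive_def by blast
  from g obtain q where q: "\<And>xs. length xs = Suc (Suc k) \<Longrightarrow> eval q xs (g xs)"
    unfolding recursive_def by blast
  have "eval (PrimRec p q) (m # xs) (h (m # xs))" if xs: "length xs = k" for m xs
  proof (induction m)
    case 0
    then show ?case using p[OF xs] h0[OF xs] by (auto intro: eval.PrimRec_0)
  next
    case (Suc m)
    then show ?case using q[of "m # h (m # xs) # xs"] xs hS[OF xs]
      by (auto intro: eval.PrimRec_Suc)
  qed
  then show ?thesis
    unfolding recursive_def by (metis length_Suc_conv)
qed

text \<open>Totality of \<open>f\<close> makes the search body defined below the result, and
  minimality makes its values there positive.\<close>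

lemma recursive_Least:
  assumes f: "recursive (Suc k) f" and ex: "\<And>xs. length xs = k \<Longrightarrow> \<exists>m. f (m # xs) = 0"
  shows "recursive k (\<lambda>xs. LEAST m. f (m # xs) = 0)"
proof -
  from f obtain p where p: "\<And>xs. length xs = Suc k \<Longrightarrow> eval p xs (f xs)"
    unfolding recursive_def by blast
  have "eval (Mu p) xs (LEAST m. f (m # xs) = 0)" if xs: "length xs = k" for xs
  proof (rule eval.Mu)
    show "eval p ((LEAST m. f (m # xs) = 0) # xs) 0"
      using p[of "(LEAST m. f (m # xs) = 0) # xs"] LeastI_ex[OF ex[OF xs]] xs by simp
    show "\<forall>i<LEAST m. f (m # xs) = 0. \<exists>y. eval p (i # xs) (Suc y)"
    proof (intro allI impI)
      fix i assume "i < (LEAST m. f (m # xs) = 0)"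
      then have "f (i # xs) \<noteq> 0" by (rule not_less_Least)
      then show "\<exists>y. eval p (i # xs) (Suc y)"
        using p[of "i # xs"] xs by (metis length_Cons not0_implies_Suc)
    qed
  qed
  then show ?thesis unfolding recursive_def by blast
qed

lemma recursive_add:
  assumes "recursive k f" "recursive k g" shows "recursive k (\<lambda>xs. f xs + g xs)"
proof (rule recursive_comp2[of "\<lambda>x y. x + y", OF _ assms])
  have "recursive (Suc 1) (\<lambda>xs. xs ! 0 + xs ! 1)"
    by (rule recursive_primrec[of _ "\<lambda>xs. xs ! 0" "\<lambda>xs. Suc (xs ! 1)"])
      (auto intro: recursive_nth recursive_Suc)
  then show "recursive 2 (\<lambda>xs. xs ! 0 + xs ! 1)" by (simp add: numeral_2_eq_2)
qed

lemma recursive_pred: "recursive k f \<Longrightarrow> recursive k (\<lambda>xs. f xs - Suc 0)"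
proof (rule recursive_comp1[of "\<lambda>x. x - Suc 0"])
  show "recursive 1 (\<lambda>xs. xs ! 0 - Suc 0)"
    unfolding One_nat_def
    by (rule recursive_primrec[of _ "\<lambda>xs. 0" "\<lambda>xs. xs ! 0"])
      (auto intro: recursive_nth recursive_const)
qed

lemma recursive_diff:
  assumes "recursive k f" "recursive k g" shows "recursive k (\<lambda>xs. f xs - g xs)"
\<comment> \<open>Primitive recursion acts on the first argument, so the subtrahend is put
  first.\<close>
proof (rule recursive_comp2[of "\<lambda>y x. x - y", OF _ assms(2,1)])
  have "recursive (Suc 1) (\<lambda>xs. xs ! 1 - xs ! 0)"
    by (rule recursive_primrec[of _ "\<lambda>xs. xs ! 0" "\<lambda>xs. xs ! 1 - Suc 0"])
      (auto intro: recursive_nth recursive_pred)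
  then show "recursive 2 (\<lambda>xs. xs ! 1 - xs ! 0)" by (simp add: numeral_2_eq_2)
qed

section \<open>Recursive inverses of pairing functions\<close>

lemma recursive_triangle: "recursive k f \<Longrightarrow> recursive k (\<lambda>xs. triangle (f xs))"
proof (rule recursive_comp1[of triangle])
  show "recursive 1 (\<lambda>xs. triangle (xs ! 0))"
    unfolding One_nat_def
    by (rule recursive_primrec[of _ "\<lambda>xs. 0" "\<lambda>xs. xs ! 1 + Suc (xs ! 0)"])
      (auto intro!: recursive_nth recursive_const recursive_add recursive_Suc)
qed

lemma recursive_prod_encode:
  "recursive k f \<Longrightarrow> recursive k g \<Longrightarrow> recursive k (\<lambda>xs. prod_encode (f xs, g xs))"
  unfolding prod_encode_def by (simp add: recursive_add recursive_triangle)

text \<open>The index of the diagonal containing \<open>m\<close> in the Cantor enumeration. The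
  truncated difference adds one exactly when \<open>Suc m\<close> reaches the next triangular
  number.\<close>

primrec triangle_root :: "nat \<Rightarrow> nat" where
  "triangle_root 0 = 0"
| "triangle_root (Suc m) =
     triangle_root m + (1 - (triangle (Suc (triangle_root m)) - Suc m))"

lemma triangle_root_bounds:
  "triangle (triangle_root m) \<le> m \<and> m < triangle (Suc (triangle_root m))"
proof (induction m)
  case (Suc m)
  show ?case
  proof (cases "Suc m < triangle (Suc (triangle_root m))")
    case True
    then have "triangle_root (Suc m) = Suc (triangle_root m) - 1" by simp
    with True Suc show ?thesis by simp
  next
    case False
    \<comment> \<open>The induction hypothesis rules out overshooting, so the root advances by
      exactly one here.\<close>
    then have "Suc m = triangle (Suc (triangle_root m))" using Suc by linarith
    then show ?thesis by simp
  qed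
qed simp

lemma triangle_mono: "m \<le> n \<Longrightarrow> triangle m \<le> triangle n"
  by (induction rule: dec_induct) auto

text \<open>The code is \<open>triangle (a + b) + a\<close>, which lies before the next triangular
  number; monotonicity leaves \<open>a + b\<close> as the only possible root.\<close>

lemma triangle_root_prod_encode: "triangle_root (prod_encode (a, b)) = a + b"
proof -
  let ?m = "prod_encode (a, b)"
  have "triangle (a + b) \<le> ?m" "?m < triangle (Suc (a + b))"
    by (auto simp: prod_encode_def)
  then show ?thesis
    using triangle_root_bounds[of ?m] triangle_mono[of "Suc (a + b)" "triangle_root ?m"]
      triangle_mono[of "Suc (triangle_root ?m)" "a + b"]
    by linarith
qed

text \<open>The offset on the diagonal. Arithmetic formulas for both projections reduce their
  recursiveness to closure properties.\<close>

definition cantor_fst :: "nat \<Rightarrow> nat" where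
  "cantor_fst m = m - triangle (triangle_root m)"

definition cantor_snd :: "nat \<Rightarrow> nat" where
  "cantor_snd m = triangle_root m - cantor_fst m"

lemma cantor_prod_encode [simp]:
  "cantor_fst (prod_encode (a, b)) = a" "cantor_snd (prod_encode (a, b)) = b"
  unfolding cantor_fst_def cantor_snd_def triangle_root_prod_encode
  by (simp_all add: prod_encode_def)

lemma recursive_triangle_root: "recursive k f \<Longrightarrow> recursive k (\<lambda>xs. triangle_root (f xs))"
proof (rule recursive_comp1[of triangle_root])
  show "recursive 1 (\<lambda>xs. triangle_root (xs ! 0))"
    unfolding One_nat_def
    by (rule recursive_primrec[of _ "\<lambda>xs. 0"
          "\<lambda>xs. xs ! 1 + (1 - (triangle (Suc (xs ! 1)) - Suc (xs ! 0)))"])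
      (auto intro!: recursive_nth recursive_const recursive_add recursive_Suc recursive_diff
        recursive_triangle simp del: triangle_Suc)
qed

lemma recursive_cantor:
  assumes "recursive k f"
  shows "recursive k (\<lambda>xs. cantor_fst (f xs))" "recursive k (\<lambda>xs. cantor_snd (f xs))"
  unfolding cantor_fst_def cantor_snd_def
  by (intro recursive_diff recursive_triangle recursive_triangle_root assms)+

text \<open>Search yields a single number, so it ranges over Cantor codes of pairs. Surjectivity of
  \<open>J\<close> makes the search total, and injectivity identifies the pair found.\<close>

lemma pairing_inverse:
  assumes "pairing J"
  obtains K K' where "recursive 1 (\<lambda>xs. K (xs ! 0))" "recursive 1 (\<lambda>xs. K' (xs ! 0))"
    "\<And>a b. K (J a b) = a" "\<And>a b. K' (J a b) = b"
proof -
  let ?J = "\<lambda>m. J (cantor_fst m) (cantor_snd m)"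
  \<comment> \<open>The sum of both truncated differences is the distance, which vanishes exactly
    when \<open>m\<close> decodes to a preimage of \<open>c\<close>.\<close>
  define d where "d m c = (?J m - c) + (c - ?J m)" for m c
  define w where "w c = (LEAST m. d m c = 0)" for c
  have rJ: "recursive 2 (\<lambda>xs. J (xs ! 0) (xs ! 1))" and bij: "bij (\<lambda>(x, y). J x y)"
    using assms unfolding pairing_def by auto
  have ex: "\<exists>m. d m c = 0" for c
  proof -
    obtain a b where "J a b = c"
      using bij by (metis bij_pointE case_prod_conv surj_pair)
    then have "d (prod_encode (a, b)) c = 0" by (simp add: d_def)
    then show ?thesis ..
  qed
  have "recursive (Suc 1) (\<lambda>xs. d (xs ! 0) (xs ! 1))"
    unfolding d_def
    by (intro recursive_add recursive_diff recursive_comp2[OF rJ] recursive_cantor recursive_nth)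
      auto
  from recursive_Least[OF this] have w: "recursive 1 (\<lambda>xs. w (xs ! 0))"
    unfolding w_def by (simp add: ex)
  have "d (w c) c = 0" for c
    unfolding w_def using ex by (rule LeastI_ex)
  then have "?J (w c) = c" for c
    unfolding d_def by (metis add_is_0 diff_is_0_eq le_antisym)
  then have "cantor_fst (w (J a b)) = a \<and> cantor_snd (w (J a b)) = b" for a b
    using injD[OF bij_is_inj[OF bij], of "(cantor_fst (w (J a b)), cantor_snd (w (J a b)))" "(a, b)"]
    by simp
  then show thesis
    using that[of "\<lambda>c. cantor_fst (w c)" "\<lambda>c. cantor_snd (w c)"] recursive_cantor[OF w] by blast
qed

section \<open>RE relations and their indices\<close>

lemma re_rel_vimage:
  assumes M: "re_rel (length fs) M" and fs: "\<And>f. f \<in> set fs \<Longrightarrow> recursive k f"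
  shows "re_rel k {xs. length xs = k \<and> map (\<lambda>f. f xs) fs \<in> M}"
proof -
  from M obtain p where p: "M = {xs. length xs = length fs \<and> (\<exists>y. eval p xs y)}"
    unfolding re_rel_def by blast
  from fs obtain P where P: "\<And>f xs. f \<in> set fs \<Longrightarrow> length xs = k \<Longrightarrow> eval (P f) xs (f xs)"
    unfolding recursive_def by metis
  have "(\<exists>y. eval (Comp p (map P fs)) xs y) \<longleftrightarrow> (\<exists>y. eval p (map (\<lambda>f. f xs) fs) y)"
    if xs: "length xs = k" for xs
  proof
    assume "\<exists>y. eval (Comp p (map P fs)) xs y"
    then obtain y ys where ys: "list_all2 (\<lambda>g y. eval g xs y) (map P fs) ys" "eval p ys y"
      by (auto elim: eval.cases)
    \<comment> \<open>Determinism forces the inner results, so the composition halts exactly where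
      \<open>p\<close> halts on them.\<close>
    have "ys = map (\<lambda>f. f xs) fs"
      using ys(1) eval_deterministic[OF _ P[OF _ xs]]
      by (auto simp: list_all2_conv_all_nth intro!: nth_equalityI)
    with ys(2) show "\<exists>y. eval p (map (\<lambda>f. f xs) fs) y" by blast
  qed (use P[OF _ xs] eval_Comp_map in blast)
  then have "{xs. length xs = k \<and> map (\<lambda>f. f xs) fs \<in> M} =
      {xs. length xs = k \<and> (\<exists>y. eval (Comp p (map P fs)) xs y)}"
    unfolding p by auto
  then show ?thesis unfolding re_rel_def by blast
qed

lemma acceptable_length:
  assumes "acceptable R" "k \<ge> 1" "xs \<in> R k i"
  shows "length xs = k"
proof -
  have "range (R k) = {M. re_rel k M}" using assms(1,2) unfolding acceptable_def by simp
  then have "re_rel k (R k i)" by blast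
  with assms(3) show ?thesis unfolding re_rel_def by auto
qed

text \<open>The universal relation for arity \<open>n + 1\<close> is pulled back along the unpairing
  of one coordinate; the iteration theorem then absorbs the index \<open>i\<close>, so that
  \<open>h i\<close> is \<open>s [e, i]\<close>.\<close>

lemma acceptable_pairing:
  assumes R: "acceptable R" and J: "pairing J" and n: "n \<ge> 1"
  obtains h where "recursive 1 (\<lambda>xs. h (xs ! 0))"
    "\<And>i a b cs. length cs = n - 1 \<Longrightarrow> J a b # cs \<in> R n (h i) \<longleftrightarrow> a # b # cs \<in> R (Suc n) i"
proof -
  obtain K K' where K: "recursive 1 (\<lambda>xs. K (xs ! 0))" "recursive 1 (\<lambda>xs. K' (xs ! 0))"
      "\<And>a b. K (J a b) = a" "\<And>a b. K' (J a b) = b"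
    using pairing_inverse[OF J] by blast
  \<comment> \<open>On \<open>i # z # cs\<close> these return \<open>i\<close>, the two components
    of \<open>z\<close>, and \<open>cs\<close>: \<open>n + 2\<close> values in all, as
    \<open>?U\<close> expects.\<close>
  let ?fs = "(\<lambda>xs. xs ! 0) # (\<lambda>xs. K (xs ! 1)) # (\<lambda>xs. K' (xs ! 1)) #
    map (\<lambda>i xs. xs ! i) [2..<Suc n]"
  let ?U = "{i # xs | i xs. xs \<in> R (Suc n) i}"
  have len: "length ?fs = Suc (Suc n)" using n by (cases n) auto
  have range: "range (R (Suc n)) = {M. re_rel (Suc n) M}"
    using R unfolding acceptable_def by simp
  let ?W = "{xs. length xs = Suc n \<and> map (\<lambda>f. f xs) ?fs \<in> ?U}"
  have "re_rel (Suc n) ?W"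
  proof (rule re_rel_vimage)
    show "re_rel (length ?fs) ?U"
      using R unfolding len acceptable_def by simp
    show "recursive (Suc n) f" if "f \<in> set ?fs" for f
      using that n
      by (auto intro!: recursive_nth recursive_comp1[OF K(1)] recursive_comp1[OF K(2)])
  qed
  then obtain e where e: "R (Suc n) e = ?W"
    using range by (metis (mono_tags, lifting) imageE mem_Collect_eq)
  \<comment> \<open>The index \<open>e\<close> of \<open>?W\<close> stays fixed; the single
    parameter moved into the index is \<open>i\<close>.\<close>
  from R n obtain s where s: "recursive (Suc 1) s"
    "\<And>i xs ys. length xs = 1 \<Longrightarrow> length ys = n \<Longrightarrow> ys \<in> R n (s (i # xs)) \<longleftrightarrow> xs @ ys \<in> R (1 + n) i"
    unfolding acceptable_def by (elim conjE allE[of _ 1] allE[of _ n]) (use n in auto)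
  have sh: "recursive 1 (\<lambda>xs. s [e, xs ! 0])"
    using recursive_comp[of "[\<lambda>_. e, \<lambda>xs. xs ! 0]" s 1] s(1)
    by (auto simp: numeral_2_eq_2 intro: recursive_const recursive_nth)
  have "J a b # cs \<in> R n (s [e, i]) \<longleftrightarrow> a # b # cs \<in> R (Suc n) i"
    if cs: "length cs = n - 1" for i a b cs
  proof -
    have "map (\<lambda>j. (i # J a b # cs) ! j) [2..<Suc n] = cs"
      using cs n by (auto intro!: nth_equalityI simp del: upt_Suc)
    then have "i # J a b # cs \<in> ?W \<longleftrightarrow> a # b # cs \<in> R (Suc n) i"
      using cs n by (simp add: K comp_def del: upt_Suc)
    then show ?thesis
      using s(2)[of "[i]" "J a b # cs" e] cs n by (simp add: e)
  qed
  with sh show thesis by (rule that)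
qed


section \<open>Natural deduction\<close>

lemma subst_tm_cong: "(\<And>v. v \<in> fv_tm t \<Longrightarrow> \<sigma> v = \<tau> v) \<Longrightarrow> subst_tm \<sigma> t = subst_tm \<tau> t"
proof (induction t)
  case (Fn f ts)
  have "subst_tm \<sigma> t = subst_tm \<tau> t" if "t \<in> set ts" for t
    using that by (intro Fn.IH Fn.prems) auto
  then show ?case by simp
qed simp

lemma subst_cong: "(\<And>v. v \<in> fv \<phi> \<Longrightarrow> \<sigma> v = \<tau> v) \<Longrightarrow> subst \<sigma> \<phi> = subst \<tau> \<phi>"
proof (induction \<phi> arbitrary: \<sigma> \<tau>)
  case (Eq s t)
  have "subst_tm \<sigma> s = subst_tm \<tau> s" "subst_tm \<sigma> t = subst_tm \<tau> t"
    using Eq by (auto intro!: subst_tm_cong)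
  then show ?case by simp
next
  case (Rel p ts)
  have "subst_tm \<sigma> t = subst_tm \<tau> t" if "t \<in> set ts" for t
    using that by (intro subst_tm_cong Rel) auto
  then show ?case by simp
next
  case (Imp \<phi> \<psi>)
  have "subst \<sigma> \<phi> = subst \<tau> \<phi>" "subst \<sigma> \<psi> = subst \<tau> \<psi>"
    by (rule Imp.IH; rule Imp.prems; simp)+
  then show ?case by simp
next
  case (All \<phi>)
  have "subst (case_nat (Var 0) (\<lambda>v. subst_tm (\<lambda>w. Var (Suc w)) (\<sigma> v))) \<phi> =
      subst (case_nat (Var 0) (\<lambda>v. subst_tm (\<lambda>w. Var (Suc w)) (\<tau> v))) \<phi>"
  proof (rule All.IH)
    fix v assume "v \<in> fv \<phi>"
    then show "case_nat (Var 0) (\<lambda>v. subst_tm (\<lambda>w. Var (Suc w)) (\<sigma> v)) v =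
        case_nat (Var 0) (\<lambda>v. subst_tm (\<lambda>w. Var (Suc w)) (\<tau> v)) v"
      using All.prems by (cases v) auto
  qed
  then show ?case by simp
qed simp

lemma subst_tm_Var [simp]: "subst_tm Var t = t"
  by (induction t) (auto intro: map_idI)

lemma subst_tm_subst_tm [simp]:
  "subst_tm \<tau> (subst_tm \<sigma> t) = subst_tm (\<lambda>v. subst_tm \<tau> (\<sigma> v)) t"
  by (induction t) auto

lemma lift_Var: "case_nat (Var 0) (\<lambda>v. Var (Suc v)) = Var"
  by (auto split: nat.split)

lemma subst_Var [simp]: "subst Var \<phi> = \<phi>"
  by (induction \<phi>) (auto simp: lift_Var intro: map_idI)

lemma subst_subst [simp]: "subst \<tau> (subst \<sigma> \<phi>) = subst (\<lambda>v. subst_tm \<tau> (\<sigma> v)) \<phi>"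
proof (induction \<phi> arbitrary: \<sigma> \<tau>)
  case (All \<phi>)
  then show ?case by (auto intro!: subst_cong split: nat.split)
qed auto

text \<open>Substitution commutes with instantiating a bound variable, in the composed form to which
  \<open>subst_subst\<close> rewrites both sides.\<close>

lemma subst_case_nat:
  "subst (\<lambda>v. subst_tm \<sigma> (case_nat t Var v)) \<phi> =
   subst (\<lambda>v. subst_tm (case_nat (subst_tm \<sigma> t) Var)
     (case_nat (Var 0) (\<lambda>v. subst_tm (\<lambda>w. Var (Suc w)) (\<sigma> v)) v)) \<phi>"
  by (rule subst_cong) (simp split: nat.split)

lemma subst_id: "(\<And>v. v \<in> fv \<phi> \<Longrightarrow> \<sigma> v = Var v) \<Longrightarrow> subst \<sigma> \<phi> = \<phi>"
  using subst_cong[of \<phi> \<sigma> Var] by simp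

lemma wf_subst_tm: "wf_tm L t \<Longrightarrow> (\<And>v. wf_tm L (\<sigma> v)) \<Longrightarrow> wf_tm L (subst_tm \<sigma> t)"
  by (induction t) auto

lemma wf_subst: "wf_fm L \<phi> \<Longrightarrow> (\<And>v. wf_tm L (\<sigma> v)) \<Longrightarrow> wf_fm L (subst \<sigma> \<phi>)"
proof (induction \<phi> arbitrary: \<sigma>)
  case (All \<phi>)
  have "wf_tm L (case_nat (Var 0) (\<lambda>v. subst_tm (\<lambda>w. Var (Suc w)) (\<sigma> v)) v)" for v
    using All.prems(2) by (auto intro!: wf_subst_tm split: nat.split)
  with All show ?case by simp
qed (auto intro!: wf_subst_tm)

lemma wf_subst_tmD: "wf_tm L (subst_tm \<sigma> t) \<Longrightarrow> wf_tm L t"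
  by (induction t) auto

text \<open>Recovers well-formedness of the formula in the Leibniz rule, whose premises mention only
  an instance of it.\<close>

lemma wf_substD: "wf_fm L (subst \<sigma> \<phi>) \<Longrightarrow> wf_fm L \<phi>"
  by (induction \<phi> arbitrary: \<sigma>) (auto dest: wf_subst_tmD)

lemma fv_tm_rename: "fv_tm (subst_tm (\<lambda>v. Var (r v)) t) = r ` fv_tm t"
  by (induction t) auto

lemma fv_rename: "fv (rename r \<phi>) = r ` fv \<phi>"
proof (induction \<phi> arbitrary: r)
  case (All \<phi>)
  \<comment> \<open>Lifting a renaming under a quantifier gives a renaming again, so the induction
    hypothesis applies.\<close>
  have "(\<lambda>v. case v of 0 \<Rightarrow> Var 0 | Suc w \<Rightarrow> subst_tm (\<lambda>w. Var (Suc w)) (Var (r w))) =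
      (\<lambda>v. Var (case v of 0 \<Rightarrow> 0 | Suc w \<Rightarrow> Suc (r w)))"
    by (auto split: nat.split)
  then have "fv (rename r (All \<phi>)) = {v. Suc v \<in> case_nat 0 (\<lambda>w. Suc (r w)) ` fv \<phi>}"
    using All[of "case_nat 0 (\<lambda>w. Suc (r w))"] by (simp only: subst.simps fv.simps)
  also have "\<dots> = r ` fv (All \<phi>)"
    by (force simp: image_iff gr0_conv_Suc split: nat.splits)
  finally show ?case .
qed (auto simp: fv_tm_rename)

lemma wf_Exs [simp]: "wf_fm L (Exs k \<phi>) \<longleftrightarrow> wf_fm L \<phi>"
  by (induction k) auto

lemma fv_Exs [simp]: "fv (Exs k \<phi>) = {v. v + k \<in> fv \<phi>}"
  by (induction k) auto

lemma wf_Conj [simp]: "wf_fm L (Conj \<phi>s) \<longleftrightarrow> (\<forall>\<phi>\<in>set \<phi>s. wf_fm L \<phi>)"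
  by (induction \<phi>s) auto

lemma fv_Conj [simp]: "fv (Conj \<phi>s) = (\<Union>\<phi>\<in>set \<phi>s. fv \<phi>)"
  by (induction \<phi>s) auto

lemma subst_Conj [simp]: "subst \<sigma> (Conj \<phi>s) = Conj (map (subst \<sigma>) \<phi>s)"
  by (induction \<phi>s) auto

section \<open>Derived rules of natural deduction\<close>

lemma prv_mono: "prv L \<Gamma> \<phi> \<Longrightarrow> \<Gamma> \<subseteq> \<Delta> \<Longrightarrow> prv L \<Delta> \<phi>"
proof (induction arbitrary: \<Delta> rule: prv.induct)
  case (ImpI \<phi> \<Gamma> \<psi>)
  then show ?case by (meson insert_mono prv.ImpI)
next
  case (Classical \<phi> \<Gamma>)
  then show ?case by (meson insert_mono prv.Classical)
next
  case (AllI \<Gamma> \<phi>)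
  then show ?case by (blast intro: prv.AllI)
qed (blast intro: prv.intros)+

lemma prv_wf: "prv L \<Gamma> \<phi> \<Longrightarrow> wf_fm L \<phi>"
proof (induction rule: prv.induct)
  case (AllE \<Gamma> \<phi> t)
  then show ?case by (auto intro!: wf_subst split: nat.split)
next
  case (Leibniz \<Gamma> s t \<phi>)
  then show ?case by (auto intro!: wf_subst dest: wf_substD split: nat.split)
qed auto

text \<open>By induction over all substitutions, since generalization calls for the lifted one:
  applied to the shifted context, it gives the shift of the substituted context.\<close>

lemma prv_subst:
  assumes "prv L \<Gamma> \<phi>" "\<And>v. wf_tm L (\<sigma> v)"
  shows "prv L (subst \<sigma> ` \<Gamma>) (subst \<sigma> \<phi>)"
  using assms
proof (induction arbitrary: \<sigma> rule: prv.induct)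
  case (Assm \<phi> \<Gamma>)
  then show ?case by (intro prv.Assm wf_subst) auto
next
  case (ImpI \<phi> \<Gamma> \<psi>)
  then show ?case using prv.ImpI[OF wf_subst] by simp
next
  case (ImpE \<Gamma> \<phi> \<psi>)
  show ?case using prv.ImpE[OF _ ImpE.IH(2)] ImpE.IH(1)[of \<sigma>] ImpE.prems by simp
next
  case (Classical \<phi> \<Gamma>)
  then show ?case using prv.Classical[OF wf_subst] by simp
next
  case (AllI \<Gamma> \<phi>)
  let ?\<sigma> = "case_nat (Var 0) (\<lambda>v. subst_tm (\<lambda>w. Var (Suc w)) (\<sigma> v))"
  have "wf_tm L (?\<sigma> v)" for v
    using AllI.prems by (auto intro!: wf_subst_tm split: nat.split)
  with AllI.IH[of ?\<sigma>] have "prv L (rename Suc ` subst \<sigma> ` \<Gamma>) (subst ?\<sigma> \<phi>)"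
    by (simp add: image_image)
  then show ?case by (simp add: prv.AllI)
next
  case (AllE \<Gamma> \<phi> t)
  have "prv L (subst \<sigma> ` \<Gamma>) (All (subst (case_nat (Var 0) (\<lambda>v. subst_tm (\<lambda>w. Var (Suc w)) (\<sigma> v))) \<phi>))"
    using AllE.IH[OF AllE.prems] by simp
  from prv.AllE[OF this wf_subst_tm[OF AllE.hyps(2) AllE.prems]]
  show ?case by (simp add: subst_case_nat)
next
  case (Refl t \<Gamma>)
  then show ?case by (simp add: prv.Refl wf_subst_tm)
next
  case (Leibniz \<Gamma> s t \<phi>)
  have eq: "prv L (subst \<sigma> ` \<Gamma>) (Eq (subst_tm \<sigma> s) (subst_tm \<sigma> t))"
    using Leibniz.IH(1)[OF Leibniz.prems] by simp
  show ?case
    using prv.Leibniz[OF eq, of "subst (case_nat (Var 0) (\<lambda>v. subst_tm (\<lambda>w. Var (Suc w)) (\<sigma> v))) \<phi>"]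
      Leibniz.IH(2)[OF Leibniz.prems]
    by (simp add: subst_case_nat)
qed

lemma prv_insertI: "wf_fm L \<phi> \<Longrightarrow> prv L (insert \<phi> \<Gamma>) \<phi>"
  by (rule prv.Assm) auto

lemma prv_Bot: "prv L \<Gamma> Bot \<Longrightarrow> wf_fm L \<phi> \<Longrightarrow> prv L \<Gamma> \<phi>"
  by (meson prv.Classical prv_mono subset_insertI)

lemma prv_contrapos:
  assumes "prv L \<Gamma> (Imp \<phi> \<psi>)" "prv L \<Gamma> (Neg \<psi>)"
  shows "prv L \<Gamma> (Neg \<phi>)"
proof -
  have wf: "wf_fm L \<phi>" using prv_wf[OF assms(1)] by simp
  have "prv L (insert \<phi> \<Gamma>) \<psi>"
    using prv.ImpE[OF prv_mono[OF assms(1)] prv_insertI[OF wf]] by blast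
  then have "prv L (insert \<phi> \<Gamma>) Bot"
    using prv.ImpE[OF prv_mono[OF assms(2)]] by blast
  with wf show ?thesis by (rule prv.ImpI)
qed

text \<open>Conjunction abbreviates a negated implication, so the projections are classical: the
  negation of either conjunct proves that implication.\<close>

lemma prv_And [simp]: "prv L \<Gamma> (And \<phi> \<psi>) \<longleftrightarrow> prv L \<Gamma> \<phi> \<and> prv L \<Gamma> \<psi>"
proof (intro iffI conjI)
  assume A: "prv L \<Gamma> (And \<phi> \<psi>)"
  then have wf: "wf_fm L \<phi>" "wf_fm L \<psi>" using prv_wf by force+
  show "prv L \<Gamma> \<phi>"
  proof (rule prv.Classical)
    let ?\<Gamma> = "insert (Neg \<phi>) \<Gamma>"
    have "prv L (insert \<phi> ?\<Gamma>) Bot"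
      by (rule prv.ImpE[of _ _ \<phi>]; rule prv.Assm) (use wf in auto)
    then have "prv L ?\<Gamma> (Imp \<phi> (Neg \<psi>))"
      by (rule prv.ImpI[OF wf(1) prv_Bot]) (use wf in simp)
    then show "prv L ?\<Gamma> Bot"
      using prv.ImpE[OF prv_mono[OF A]] by blast
  qed (rule wf)
  show "prv L \<Gamma> \<psi>"
  proof (rule prv.Classical)
    let ?\<Gamma> = "insert (Neg \<psi>) \<Gamma>"
    have "prv L ?\<Gamma> (Imp \<phi> (Neg \<psi>))"
      by (rule prv.ImpI[OF wf(1)], rule prv.Assm) (use wf in auto)
    then show "prv L ?\<Gamma> Bot"
      using prv.ImpE[OF prv_mono[OF A]] by blast
  qed (rule wf)
next
  assume A: "prv L \<Gamma> \<phi> \<and> prv L \<Gamma> \<psi>"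
  then have wf: "wf_fm L (Imp \<phi> (Neg \<psi>))" using prv_wf by force
  let ?\<Gamma> = "insert (Imp \<phi> (Neg \<psi>)) \<Gamma>"
  have "prv L ?\<Gamma> \<phi>" "prv L ?\<Gamma> \<psi>" using A prv_mono by blast+
  then have "prv L ?\<Gamma> Bot"
    using prv.ImpE[OF prv.ImpE[OF prv_insertI[OF wf]]] by blast
  with wf show "prv L \<Gamma> (And \<phi> \<psi>)" by (rule prv.ImpI)
qed

lemma prv_Conj [simp]: "prv L \<Gamma> (Conj \<phi>s) \<longleftrightarrow> (\<forall>\<phi>\<in>set \<phi>s. prv L \<Gamma> \<phi>)"
proof (induction \<phi>s)
  case Nil
  show ?case using prv.ImpI[OF _ prv_insertI[of L Bot \<Gamma>]] by simp
qed simp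

lemma prv_Eq_sym:
  assumes "prv L \<Gamma> (Eq s t)" shows "prv L \<Gamma> (Eq t s)"
proof -
  have "prv L \<Gamma> (Eq s s)" using prv_wf[OF assms] by (auto intro: prv.Refl)
  \<comment> \<open>Leibniz for the formula \<open>x = s\<close>, with \<open>s\<close> raised past
    \<open>x\<close>: the instance at \<open>s\<close> is reflexivity, the one at \<open>t\<close>
    is the claim.\<close>
  then show ?thesis
    using prv.Leibniz[OF assms, of "Eq (Var 0) (subst_tm (\<lambda>v. Var (Suc v)) s)"] by simp
qed

text \<open>Constant substitutions leave no other variables to track; they agree with
  \<open>subst1\<close> when only variable 0 can be free.\<close>

lemma prv_Leibniz:
  assumes "prv L \<Gamma> (Eq s t)" "prv L \<Gamma> (subst (\<lambda>_. s) \<phi>)" "fv \<phi> \<subseteq> {0}"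
  shows "prv L \<Gamma> (subst (\<lambda>_. t) \<phi>)"
proof -
  have "subst1 u \<phi> = subst (\<lambda>_. u) \<phi>" for u
    using assms(3) by (auto intro!: subst_cong)
  with prv.Leibniz[OF assms(1), of \<phi>] assms(2) show ?thesis by simp
qed

lemma prv_ExI:
  assumes "prv L \<Gamma> (subst1 t \<phi>)" "wf_tm L t"
  shows "prv L \<Gamma> (Ex \<phi>)"
proof (rule prv.ImpI)
  show wf: "wf_fm L (All (Neg \<phi>))"
    using prv_wf[OF assms(1)] wf_substD by fastforce
  let ?\<Gamma> = "insert (All (Neg \<phi>)) \<Gamma>"
  have "prv L ?\<Gamma> (Neg (subst1 t \<phi>))"
    using prv.AllE[OF prv_insertI[OF wf] assms(2)] by simp
  then show "prv L ?\<Gamma> Bot"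
    using prv.ImpE prv_mono[OF assms(1)] by blast
qed

text \<open>By contradiction: \<open>Neg \<chi>\<close> refutes \<open>\<phi>\<close> for a generic
  variable, and generalizing contradicts the existential formula.\<close>

lemma prv_ExE:
  assumes ex: "prv L \<Gamma> (Ex \<phi>)" and "prv L (insert \<phi> (rename Suc ` \<Gamma>)) (rename Suc \<chi>)"
  shows "prv L \<Gamma> \<chi>"
proof (rule prv.Classical)
  show wf: "wf_fm L \<chi>" using prv_wf[OF assms(2)] wf_substD by blast
  have wf': "wf_fm L \<phi>" using prv_wf[OF ex] by simp
  let ?\<Delta> = "insert \<phi> (rename Suc ` insert (Neg \<chi>) \<Gamma>)"
  have "prv L ?\<Delta> (rename Suc \<chi>)" by (rule prv_mono[OF assms(2)]) auto
  moreover have "prv L ?\<Delta> (Neg (rename Suc \<chi>))"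
    by (rule prv.Assm) (use wf in \<open>auto intro!: wf_subst\<close>)
  ultimately have "prv L ?\<Delta> Bot" using prv.ImpE by blast
  then have "prv L (insert (Neg \<chi>) \<Gamma>) (All (Neg \<phi>))"
    by (intro prv.AllI prv.ImpI wf')
  then show "prv L (insert (Neg \<chi>) \<Gamma>) Bot"
    using prv.ImpE[OF prv_mono[OF ex]] by blast
qed

section \<open>Blocks of existential quantifiers\<close>

lemma Exs_Suc: "Exs (Suc k) \<phi> = Exs k (Ex \<phi>)"
  by (simp only: funpow_Suc_right o_apply)

text \<open>The innermost quantifier binds variable 0, so peeling it off uses the witness
  \<open>s 0\<close> and shifts the others down. \<open>\<sigma>\<close> is carried along because a
  block may have to be introduced inside an instance.\<close>

lemma prv_subst_ExsI:
  assumes "prv L \<Gamma> (subst (\<lambda>v. if v < k then s v else \<sigma> (v - k)) \<phi>)" "\<And>v. v < k \<Longrightarrow> wf_tm L (s v)"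
  shows "prv L \<Gamma> (subst \<sigma> (Exs k \<phi>))"
  using assms
proof (induction k arbitrary: \<phi> s)
  case (Suc k)
  let ?\<tau> = "\<lambda>v. if v < k then s (Suc v) else \<sigma> (v - k)"
  have "prv L \<Gamma> (subst ?\<tau> (Ex \<phi>))"
    unfolding subst.simps
  proof (rule prv_ExI)
    have "subst1 (s 0) (subst (case_nat (Var 0) (\<lambda>v. subst_tm (\<lambda>w. Var (Suc w)) (?\<tau> v))) \<phi>) =
        subst (\<lambda>v. if v < Suc k then s v else \<sigma> (v - Suc k)) \<phi>"
      by (auto intro!: subst_cong split: nat.split)
    with Suc.prems(1)
    show "prv L \<Gamma> (subst1 (s 0) (subst (case_nat (Var 0) (\<lambda>v. subst_tm (\<lambda>w. Var (Suc w)) (?\<tau> v))) \<phi>))"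
      by simp
  qed (use Suc.prems(2) in simp)
  then show ?case
    unfolding Exs_Suc by (rule Suc.IH) (use Suc.prems(2) in simp)
qed simp

lemma prv_ExsI:
  assumes "prv L \<Gamma> (subst (\<lambda>v. if v < k then s v else Var (v - k)) \<phi>)" "\<And>v. v < k \<Longrightarrow> wf_tm L (s v)"
  shows "prv L \<Gamma> (Exs k \<phi>)"
  using prv_subst_ExsI[of L \<Gamma> k s Var \<phi>] assms by simp

lemma prv_ExsE:
  assumes "prv L \<Gamma> (Exs k \<phi>)"
    and "prv L (insert \<phi> (rename (\<lambda>v. v + k) ` \<Gamma>)) (rename (\<lambda>v. v + k) \<chi>)"
  shows "prv L \<Gamma> \<chi>"
  using assms
proof (induction k arbitrary: \<phi>)
  case 0
  then have "prv L \<Gamma> (Imp \<phi> \<chi>)"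
    using prv_wf by (intro prv.ImpI) auto
  with 0 show ?case using prv.ImpE by simp
next
  case (Suc k)
  let ?\<Delta> = "insert (Ex \<phi>) (rename (\<lambda>v. v + k) ` \<Gamma>)"
  have wf: "wf_fm L (Ex \<phi>)" using prv_wf[OF Suc.prems(1)] by simp
  have "prv L ?\<Delta> (rename (\<lambda>v. v + k) \<chi>)"
  proof (rule prv_ExE)
    show "prv L ?\<Delta> (Ex \<phi>)" using wf by (rule prv_insertI)
    show "prv L (insert \<phi> (rename Suc ` ?\<Delta>)) (rename Suc (rename (\<lambda>v. v + k) \<chi>))"
      using prv_mono[OF Suc.prems(2)] by (auto simp: image_image)
  qed
  then show ?case
    using Suc.IH[of "Ex \<phi>"] Suc.prems(1) unfolding Exs_Suc by blast
qed

section \<open>Translated numerals and instances\<close>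

lemma wf_vsubst:
  assumes "is_transl K L I" "\<And>g. g \<in> set gs \<Longrightarrow> wf_fm L g" "wf_fm L \<phi>"
  shows "wf_fm L (vsubst I gs \<phi>)"
  using assms unfolding vsubst_def Let_def is_transl_def by (auto intro!: wf_subst)

lemma fv_vsubst:
  assumes "is_transl K L I" "\<And>g. g \<in> set gs \<Longrightarrow> fv g \<subseteq> insert 0 (Suc ` A)"
    "fv \<phi> \<subseteq> {..<length gs} \<union> (\<lambda>v. v + length gs) ` A"
  shows "fv (vsubst I gs \<phi>) \<subseteq> A"
proof -
  have "fv (rename (\<lambda>_. i) (t_dom I)) \<subseteq> {i}" for i
    by (auto simp: fv_rename)
  moreover have "fv (rename (case_nat i (\<lambda>v. v + length gs)) (gs ! i)) \<subseteq>
      insert i ((\<lambda>v. v + length gs) ` A)" if "i < length gs" for i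
    using assms(2)[OF nth_mem[OF that]] by (auto simp: fv_rename)
  ultimately show ?thesis
    using assms(3) unfolding vsubst_def Let_def by fastforce
qed

text \<open>A numeral becomes a predicate of variable 0, not a term; nothing here asserts that only
  one element satisfies it.\<close>

definition num_fm :: "transl \<Rightarrow> nat \<Rightarrow> fm" where
  "num_fm I c = And (t_dom I) (graph I (num c))"

lemma graph_num:
  assumes "is_transl num_lang L I"
  shows "wf_fm L (graph I (num c)) \<and> fv (graph I (num c)) \<subseteq> {0}"
proof (induction c)
  case 0
  have "wf_fm L (t_fun I 0 0) \<and> fv (t_fun I 0 0) \<subseteq> {0}"
    using assms unfolding is_transl_def num_lang_def by auto
  then show ?case by (simp add: vsubst_def)
next
  case (Suc c)
  let ?g = "rename (case_nat 0 (\<lambda>v. Suc (Suc v))) (graph I (num c))"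
  have F: "wf_fm L (t_fun I 1 1)" "fv (t_fun I 1 1) \<subseteq> {0, 1}"
    using assms unfolding is_transl_def num_lang_def by auto
  have "fv ?g \<subseteq> {0}"
    using Suc by (auto simp: fv_rename)
  then have "fv (vsubst I [?g] (t_fun I 1 1)) \<subseteq> {0}"
    using F(2) by (intro fv_vsubst[OF assms]) auto
  moreover have "wf_fm L (vsubst I [?g] (t_fun I 1 1))"
    using Suc F(1) by (intro wf_vsubst[OF assms]) (auto intro!: wf_subst split: nat.split)
  ultimately show ?case by simp
qed

lemma fv_num_fm: "is_transl num_lang L I \<Longrightarrow> fv (num_fm I c) \<subseteq> {0}"
  using graph_num[of L I c] unfolding num_fm_def is_transl_def by auto

text \<open>Numerals are closed, so the shift of context variables in \<open>vsubst\<close> does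
  nothing to their graphs, and domain and graph merge into \<open>num_fm\<close>.\<close>

lemma num_inst_eq:
  assumes "is_transl num_lang L I"
  shows "num_inst I as \<phi> = Exs (length as)
    (And (Conj (map (\<lambda>i. subst (\<lambda>_. Var i) (num_fm I (as ! i))) [0..<length as])) \<phi>)"
proof -
  have "rename (case_nat i (\<lambda>v. v + k)) (graph I (num c)) = rename (\<lambda>_. i) (graph I (num c))"
    for i k c
    using graph_num[OF assms, of c] by (auto intro!: subst_cong)
  then have "map (\<lambda>i. And (rename (\<lambda>_. i) (t_dom I))
        (rename (case_nat i (\<lambda>v. v + length as)) (map (\<lambda>a. graph I (num a)) as ! i))) [0..<length as] =
      map (\<lambda>i. subst (\<lambda>_. Var i) (num_fm I (as ! i))) [0..<length as]"
    by (intro map_cong) (simp_all add: num_fm_def)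
  then show ?thesis
    unfolding num_inst_def vsubst_def Let_def length_map by (simp only:)
qed

lemma wf_num_inst:
  "is_transl num_lang L I \<Longrightarrow> wf_fm L \<phi> \<Longrightarrow> wf_fm L (num_inst I as \<phi>)"
  unfolding num_inst_def by (rule wf_vsubst) (auto simp: graph_num)

lemma fv_num_inst:
  assumes "is_transl num_lang L I" "fv \<phi> \<subseteq> {..<length as} \<union> (\<lambda>v. v + length as) ` A"
  shows "fv (num_inst I as \<phi>) \<subseteq> A"
  unfolding num_inst_def
  by (rule fv_vsubst[OF assms(1)]) (use graph_num[OF assms(1)] assms(2) in auto)

lemma prv_num_instI:
  assumes I: "is_transl num_lang L I"
    and num: "\<And>i. i < length as \<Longrightarrow> prv L \<Gamma> (subst (\<lambda>_. s i) (num_fm I (as ! i)))"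
    and \<phi>: "prv L \<Gamma> (subst (\<lambda>v. if v < length as then s v else Var (v - length as)) \<phi>)"
    and s: "\<And>i. i < length as \<Longrightarrow> wf_tm L (s i)"
  shows "prv L \<Gamma> (num_inst I as \<phi>)"
  unfolding num_inst_eq[OF I]
  by (rule prv_ExsI[OF _ s]) (use num \<phi> in auto)

text \<open>The opened context is an arbitrary \<open>\<Delta>\<close> known only through what it
  proves, so that eliminations nest without explicit sets of hypotheses. Variables below
  \<open>length as\<close> are now values of the numerals.\<close>

lemma prv_num_instE:
  assumes I: "is_transl num_lang L I"
    and inst: "prv L \<Gamma> (num_inst I as \<phi>)"
    and \<chi>: "\<And>\<Delta>. rename (\<lambda>v. v + length as) ` \<Gamma> \<subseteq> \<Delta> \<Longrightarrow>
       (\<And>i. i < length as \<Longrightarrow> prv L \<Delta> (subst (\<lambda>_. Var i) (num_fm I (as ! i)))) \<Longrightarrow>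
       prv L \<Delta> \<phi> \<Longrightarrow> prv L \<Delta> (rename (\<lambda>v. v + length as) \<chi>)"
  shows "prv L \<Gamma> \<chi>"
proof (rule prv_ExsE)
  let ?A = "And (Conj (map (\<lambda>i. subst (\<lambda>_. Var i) (num_fm I (as ! i))) [0..<length as])) \<phi>"
  let ?\<Delta> = "insert ?A (rename (\<lambda>v. v + length as) ` \<Gamma>)"
  show ex: "prv L \<Gamma> (Exs (length as) ?A)"
    using inst unfolding num_inst_eq[OF I] .
  have "wf_fm L ?A" using prv_wf[OF ex] unfolding wf_Exs .
  from prv_insertI[OF this] have "prv L ?\<Delta> ?A" .
  then show "prv L ?\<Delta> (rename (\<lambda>v. v + length as) \<chi>)"
    by (intro \<chi>) auto
qed


section \<open>Contracting two variables by the pairing function\<close>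

text \<open>Strong definability enters here. Its right side says that variable 0 equals some value
  of the numeral of \<open>c\<close>, in the identity of the target theory, so Leibniz reduces it to
  \<open>num_fm I c\<close>.\<close>

lemma prv_num_inst_iff:
  assumes I: "is_transl num_lang L I" and \<theta>: "fv \<theta> \<subseteq> {0, 1, 2}"
    and def: "prv L T (All (Iff (num_inst I [a, b] \<theta>) (num_inst I [c] (Eq (Var 1) (Var 0)))))"
    and \<Gamma>: "T \<subseteq> \<Gamma>"
  shows "prv L \<Gamma> (num_inst I [a, b] \<theta>) \<longleftrightarrow> prv L \<Gamma> (num_fm I c)"
proof -
  let ?X = "num_inst I [a, b] \<theta>" and ?Y = "num_inst I [c] (Eq (Var 1) (Var 0))"
  have "fv ?X \<subseteq> {0}"
    using \<theta> by (intro fv_num_inst[OF I]) auto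
  moreover have "fv ?Y \<subseteq> {0}"
    by (intro fv_num_inst[OF I]) auto
  \<comment> \<open>Instantiation lowers all variables but 0, and only 0 can be free in
    \<open>?X\<close> and \<open>?Y\<close>.\<close>
  ultimately have "subst1 (Var 0) (Iff ?X ?Y) = Iff ?X ?Y"
    by (intro subst_id) (auto split: nat.split)
  with prv.AllE[OF def, of "Var 0"] have "prv L T (Iff ?X ?Y)" by simp
  from prv_mono[OF this \<Gamma>] have XY: "prv L \<Gamma> (Imp ?X ?Y)" "prv L \<Gamma> (Imp ?Y ?X)"
    by simp_all
  have N: "subst (\<lambda>_. Var 0) (num_fm I c) = num_fm I c"
    using fv_num_fm[OF I, of c] by (intro subst_id) auto
  show ?thesis
  proof
    assume "prv L \<Gamma> ?X"
    then have "prv L \<Gamma> ?Y" using XY(1) prv.ImpE by blast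
    then show "prv L \<Gamma> (num_fm I c)"
    proof (rule prv_num_instE[OF I])
      fix \<Delta>
      assume "\<And>i. i < length [c] \<Longrightarrow> prv L \<Delta> (subst (\<lambda>_. Var i) (num_fm I ([c] ! i)))"
        and eq: "prv L \<Delta> (Eq (Var 1) (Var 0))"
      then have "prv L \<Delta> (subst (\<lambda>_. Var 1) (num_fm I c))"
        by (intro prv_Leibniz[OF prv_Eq_sym[OF eq]] fv_num_fm[OF I]) auto
      also have "subst (\<lambda>_. Var 1) (num_fm I c) = rename (\<lambda>v. v + length [c]) (num_fm I c)"
        using fv_num_fm[OF I, of c] by (intro subst_cong) auto
      finally show "prv L \<Delta> (rename (\<lambda>v. v + length [c]) (num_fm I c))" .
    qed
  next
    assume "prv L \<Gamma> (num_fm I c)"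
    then have "prv L \<Gamma> ?Y"
      by (intro prv_num_instI[OF I, where s = "\<lambda>_. Var 0"]) (auto simp: N intro: prv.Refl)
    then show "prv L \<Gamma> ?X" using XY(2) prv.ImpE by blast
  qed
qed

text \<open>In \<open>\<exists>z\<^sub>0 \<dots> z\<^sub>m. \<theta>(x\<^sub>0, x\<^sub>1, z\<^sub>0) \<and> (\<And>i<m. z\<^sub>i\<^sub>+\<^sub>1 = x\<^sub>i\<^sub>+\<^sub>2) \<and> \<phi>(z\<^sub>0, \<dots>, z\<^sub>m)\<close>, the variable \<open>z\<^sub>i\<close> has index \<open>i\<close>
  and \<open>x\<^sub>i\<close> has index \<open>i + m + 1\<close>. The trivial equations make \<open>x\<^sub>0\<close> and \<open>x\<^sub>1\<close> occur even if they
  do not occur in \<open>\<theta>\<close>. Quantifying over all \<open>z\<^sub>i\<close>, rather than substituting into \<open>\<phi>\<close>, leaves \<open>\<phi>\<close>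
  intact, so that the code of the new formula is computed from that of \<open>\<phi>\<close> without recursion
  over formulas.\<close>

definition pair_cond :: "nat \<Rightarrow> fm \<Rightarrow> fm" where
  "pair_cond m \<theta> =
     Conj (rename (\<lambda>v. if v = 0 then Suc m else if v = 1 then Suc (Suc m) else 0) \<theta> #
       Eq (Var (Suc m)) (Var (Suc m)) # Eq (Var (Suc (Suc m))) (Var (Suc (Suc m))) #
       map (\<lambda>i. Eq (Var (Suc i)) (Var (i + m + 3))) [0..<m])"

definition pair_fm :: "nat \<Rightarrow> fm \<Rightarrow> fm \<Rightarrow> fm" where
  "pair_fm m \<theta> \<phi> = Exs (Suc m) (And (pair_cond m \<theta>) \<phi>)"

lemma wf_pair_fm: "wf_fm L \<theta> \<Longrightarrow> wf_fm L \<phi> \<Longrightarrow> wf_fm L (pair_fm m \<theta> \<phi>)"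
  unfolding pair_fm_def wf_Exs pair_cond_def by (auto intro!: wf_subst)

text \<open>The block binds every variable of \<open>\<phi>\<close>. The first two variables come
  from the trivial equations, and each \<open>v \<ge> 2\<close> from the linking equation with
  \<open>i = v - 2\<close>.\<close>

lemma fv_pair_fm:
  assumes "fv \<theta> \<subseteq> {0, 1, 2}" "fv \<phi> \<subseteq> {..<Suc m}"
  shows "fv (pair_fm m \<theta> \<phi>) = {..<Suc (Suc m)}"
proof -
  have "v \<in> fv (pair_fm m \<theta> \<phi>) \<longleftrightarrow> v < Suc (Suc m)" for v
  proof -
    have "v + Suc m \<notin> fv \<phi>" using assms(2) by auto
    moreover have "v < 2" if "v + Suc m \<in> fv (rename (\<lambda>v. if v = 0 then Suc m else if v = 1 then Suc (Suc m) else 0) \<theta>)"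
      using that by (auto simp: fv_rename split: if_splits)
    moreover have "(\<exists>i\<in>{0..<m}. v + Suc m = Suc i \<or> v + Suc m = i + m + 3) \<longleftrightarrow> 2 \<le> v \<and> v < Suc (Suc m)"
    proof
      assume "2 \<le> v \<and> v < Suc (Suc m)"
      then show "\<exists>i\<in>{0..<m}. v + Suc m = Suc i \<or> v + Suc m = i + m + 3"
        by (intro bexI[of _ "v - 2"]) auto
    qed auto
    ultimately show ?thesis
      unfolding pair_fm_def fv_Exs pair_cond_def by (auto simp del: upt_Suc)
  qed
  then show ?thesis by auto
qed

section \<open>Provable equivalence of corresponding instances\<close>

context
  fixes L T I \<theta> \<phi> a b c m and cs :: "nat list"
  assumes T: "is_theory L T" and I: "is_transl num_lang L I"
    and \<theta>: "wf_fm L \<theta>" "fv \<theta> \<subseteq> {0, 1, 2}"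
    and def: "prv L T (All (Iff (num_inst I [a, b] \<theta>) (num_inst I [c] (Eq (Var 1) (Var 0)))))"
    and \<phi>: "wf_fm L \<phi>" "fv \<phi> \<subseteq> {..<Suc m}"
    and cs: "length cs = m"
begin

text \<open>Axioms are sentences, so they survive the shift of the context at each existential
  elimination.\<close>

private lemma T_subset_rename: "T \<subseteq> \<Gamma> \<Longrightarrow> T \<subseteq> rename r ` \<Gamma>"
proof
  fix \<chi> assume "T \<subseteq> \<Gamma>" "\<chi> \<in> T"
  then have "rename r \<chi> = \<chi>" "\<chi> \<in> \<Gamma>"
    using T by (auto simp: is_theory_def sentence_def intro: subst_id)
  then show "\<chi> \<in> rename r ` \<Gamma>" by force
qed

text \<open>Every free variable has been instantiated, so the shifts imposed on the conclusion by
  existential elimination disappear.\<close>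

private lemma closed: "rename r (num_inst I (c # cs) \<phi>) = num_inst I (c # cs) \<phi>"
  "rename r (num_inst I (a # b # cs) (pair_fm m \<theta> \<phi>)) = num_inst I (a # b # cs) (pair_fm m \<theta> \<phi>)"
proof -
  have "fv (num_inst I (c # cs) \<phi>) \<subseteq> {}"
    using cs \<phi> by (intro fv_num_inst[OF I]) auto
  moreover have "fv (num_inst I (a # b # cs) (pair_fm m \<theta> \<phi>)) \<subseteq> {}"
    using cs fv_pair_fm[OF \<theta>(2) \<phi>(2)] by (intro fv_num_inst[OF I]) auto
  ultimately show "rename r (num_inst I (c # cs) \<phi>) = num_inst I (c # cs) \<phi>"
    "rename r (num_inst I (a # b # cs) (pair_fm m \<theta> \<phi>)) = num_inst I (a # b # cs) (pair_fm m \<theta> \<phi>)"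
    by (auto intro!: subst_id)
qed

private lemma prv_rename_num:
  assumes "prv L \<Gamma> (subst (\<lambda>_. Var i) (num_fm I k))" "rename r ` \<Gamma> \<subseteq> \<Delta>"
  shows "prv L \<Delta> (subst (\<lambda>_. Var (r i)) (num_fm I k))"
  using prv_mono[OF prv_subst[OF assms(1), of "\<lambda>v. Var (r v)"] assms(2)] by simp

text \<open>The premise is opened twice, giving numeral values \<open>x\<^sub>i\<close> and then the
  block variables \<open>z\<^sub>i\<close>. The latter witness the conclusion:
  \<open>z\<^sub>0\<close> is a value of \<open>c\<close> by strong definability, the others equal
  values of \<open>cs\<close>.\<close>

lemma prv_pair_fm_imp:
  "prv L T (Imp (num_inst I (a # b # cs) (pair_fm m \<theta> \<phi>)) (num_inst I (c # cs) \<phi>))"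
proof (rule prv.ImpI)
  let ?\<psi> = "pair_fm m \<theta> \<phi>" and ?\<chi> = "num_inst I (c # cs) \<phi>"
  let ?as = "a # b # cs"
  show wf: "wf_fm L (num_inst I ?as ?\<psi>)"
    by (intro wf_num_inst[OF I] wf_pair_fm \<theta> \<phi>)
  let ?\<Gamma> = "insert (num_inst I ?as ?\<psi>) T"
  show "prv L ?\<Gamma> ?\<chi>"
  proof (rule prv_num_instE[OF I prv_insertI[OF wf]])
    fix \<Delta>
    assume sub: "rename (\<lambda>v. v + length ?as) ` ?\<Gamma> \<subseteq> \<Delta>"
      and num: "\<And>i. i < length ?as \<Longrightarrow> prv L \<Delta> (subst (\<lambda>_. Var i) (num_fm I (?as ! i)))"
      and \<psi>: "prv L \<Delta> ?\<psi>"
    have T1: "T \<subseteq> \<Delta>"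
      using T_subset_rename[of ?\<Gamma> "\<lambda>v. v + length ?as"] sub by blast
    \<comment> \<open>Opening the block raises the numeral values: \<open>x\<^sub>i\<close> is now
      \<open>Var (i + Suc m)\<close>, and \<open>z\<^sub>i\<close> is \<open>Var i\<close>.\<close>
    let ?r = "\<lambda>v. v + Suc m"
    let ?B = "And (pair_cond m \<theta>) \<phi>"
    let ?\<Delta> = "insert ?B (rename ?r ` \<Delta>)"
    have "prv L ?\<Delta> (rename ?r ?\<chi>)"
    proof -
      have T2: "T \<subseteq> ?\<Delta>"
        using T_subset_rename[OF T1, of ?r] by blast
      have num2: "prv L ?\<Delta> (subst (\<lambda>_. Var (i + Suc m)) (num_fm I (?as ! i)))"
        if "i < length ?as" for i
        by (rule prv_rename_num[OF num[OF that]]) auto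
      have "wf_fm L ?B" using prv_wf[OF \<psi>] unfolding pair_fm_def wf_Exs .
      from prv_insertI[OF this] have B: "prv L ?\<Delta> ?B" .
      have eq: "prv L ?\<Delta> (Eq (Var (Suc i)) (Var (i + m + 3)))" if "i < m" for i
        using B that unfolding pair_cond_def by simp
      \<comment> \<open>With \<open>x\<^sub>0\<close> and \<open>x\<^sub>1\<close> as witnesses, the
        remaining variable of \<open>\<theta>\<close> becomes variable 0, which is
        \<open>z\<^sub>0\<close>.\<close>
      have "prv L ?\<Delta> (num_inst I [a, b] \<theta>)"
      proof (rule prv_num_instI[OF I, where s = "\<lambda>i. Var (i + Suc m)"])
        show "prv L ?\<Delta> (subst (\<lambda>_. Var (i + Suc m)) (num_fm I ([a, b] ! i)))"
          if "i < length [a, b]" for i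
          using num2[of i] that by (cases i) simp_all
        have "subst (\<lambda>v. if v < length [a, b] then Var (v + Suc m) else Var (v - length [a, b])) \<theta> =
            rename (\<lambda>v. if v = 0 then Suc m else if v = 1 then Suc (Suc m) else 0) \<theta>"
          using \<theta>(2) by (intro subst_cong) auto
        then show "prv L ?\<Delta> (subst (\<lambda>v. if v < length [a, b] then Var (v + Suc m)
            else Var (v - length [a, b])) \<theta>)"
          using B unfolding pair_cond_def by simp
      qed simp
      then have c: "prv L ?\<Delta> (num_fm I c)"
        using prv_num_inst_iff[OF I \<theta>(2) def T2] by blast
      have "prv L ?\<Delta> ?\<chi>"
      proof (rule prv_num_instI[OF I, where s = Var])
        fix i assume i: "i < length (c # cs)"
        show "prv L ?\<Delta> (subst (\<lambda>_. Var i) (num_fm I ((c # cs) ! i)))"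
        proof (cases i)
          case 0
          have "subst (\<lambda>_. Var 0) (num_fm I c) = num_fm I c"
            using fv_num_fm[OF I, of c] by (intro subst_id) auto
          with c 0 show ?thesis by simp
        next
          case (Suc j)
          with i cs have j: "j < m" by simp
          \<comment> \<open>Entry \<open>j\<close> of \<open>cs\<close> has position
            \<open>j + 2\<close> in \<open>?as\<close>, so its value is variable
            \<open>(j + 2) + (m + 1)\<close>.\<close>
          have "prv L ?\<Delta> (subst (\<lambda>_. Var (j + m + 3)) (num_fm I (cs ! j)))"
            using num2[of "j + 2"] j cs by (simp add: add.commute add.left_commute numeral_3_eq_3)
          from prv_Leibniz[OF prv_Eq_sym[OF eq[OF j]] this fv_num_fm[OF I]]
          show ?thesis using Suc by simp
        qed
      next
        have "subst (\<lambda>v. if v < length (c # cs) then Var v else Var (v - length (c # cs))) \<phi> = \<phi>"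
          using \<phi>(2) cs by (intro subst_id) auto
        then show "prv L ?\<Delta> (subst (\<lambda>v. if v < length (c # cs) then Var v
            else Var (v - length (c # cs))) \<phi>)"
          using B by simp
      qed simp
      then show ?thesis unfolding closed .
    qed
    with \<psi> have "prv L \<Delta> ?\<chi>"
      unfolding pair_fm_def by (rule prv_ExsE)
    then show "prv L \<Delta> (rename (\<lambda>v. v + length ?as) ?\<chi>)"
      unfolding closed .
  qed
qed

text \<open>Opening the premise gives values \<open>w\<^sub>0, \<dots>, w\<^sub>m\<close> satisfying
  \<open>\<phi>\<close>. As \<open>w\<^sub>0\<close> is a value of \<open>c\<close>, strong
  definability supplies values of \<open>a\<close> and \<open>b\<close> related to it by
  \<open>\<theta>\<close>; the \<open>w\<^sub>i\<close> then witness the block.\<close>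

lemma prv_imp_pair_fm:
  "prv L T (Imp (num_inst I (c # cs) \<phi>) (num_inst I (a # b # cs) (pair_fm m \<theta> \<phi>)))"
proof (rule prv.ImpI)
  let ?\<psi> = "pair_fm m \<theta> \<phi>" and ?\<chi> = "num_inst I (a # b # cs) (pair_fm m \<theta> \<phi>)"
  show wf: "wf_fm L (num_inst I (c # cs) \<phi>)"
    by (intro wf_num_inst[OF I] \<phi>)
  let ?\<Gamma> = "insert (num_inst I (c # cs) \<phi>) T"
  show "prv L ?\<Gamma> ?\<chi>"
  proof (rule prv_num_instE[OF I prv_insertI[OF wf]])
    fix \<Delta>
    assume sub: "rename (\<lambda>v. v + length (c # cs)) ` ?\<Gamma> \<subseteq> \<Delta>"
      and num: "\<And>i. i < length (c # cs) \<Longrightarrow>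
        prv L \<Delta> (subst (\<lambda>_. Var i) (num_fm I ((c # cs) ! i)))"
      and \<phi>\<Delta>: "prv L \<Delta> \<phi>"
    have T1: "T \<subseteq> \<Delta>"
      using T_subset_rename[of ?\<Gamma> "\<lambda>v. v + length (c # cs)"] sub by blast
    have "subst (\<lambda>_. Var 0) (num_fm I c) = num_fm I c"
      using fv_num_fm[OF I, of c] by (intro subst_id) auto
    with num[of 0] have "prv L \<Delta> (num_fm I c)" by simp
    then have "prv L \<Delta> (num_inst I [a, b] \<theta>)"
      using prv_num_inst_iff[OF I \<theta>(2) def T1] by blast
    then have "prv L \<Delta> ?\<chi>"
    proof (rule prv_num_instE[OF I])
      fix \<Delta>'
      assume sub': "rename (\<lambda>v. v + length [a, b]) ` \<Delta> \<subseteq> \<Delta>'"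
        and ab: "\<And>i. i < length [a, b] \<Longrightarrow>
          prv L \<Delta>' (subst (\<lambda>_. Var i) (num_fm I ([a, b] ! i)))"
        and \<theta>\<Delta>': "prv L \<Delta>' \<theta>"
      let ?as = "a # b # cs"
      \<comment> \<open>Variables 0 and 1 are the values of \<open>a\<close> and \<open>b\<close>,
        and \<open>w\<^sub>i\<close> is \<open>Var (i + 2)\<close>. \<open>Var 2\<close> is skipped:
        it is the value of \<open>c\<close>, which serves only as \<open>z\<^sub>0\<close>.\<close>
      let ?s = "\<lambda>i. if i < 2 then Var i else Var (Suc i)"
      let ?\<sigma> = "\<lambda>v. if v < length ?as then ?s v else Var (v - length ?as)"
      let ?\<tau> = "\<lambda>v. if v < Suc m then Var (v + 2) else ?\<sigma> (v - Suc m)"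
      have "prv L \<Delta>' ?\<chi>"
      proof (rule prv_num_instI[OF I, where s = ?s])
        fix i assume i: "i < length ?as"
        show "prv L \<Delta>' (subst (\<lambda>_. ?s i) (num_fm I (?as ! i)))"
        proof (cases "i < 2")
          case True
          then show ?thesis using ab[of i] by (auto simp: less_2_cases_iff)
        next
          case False
          then obtain j where j: "i = Suc (Suc j)" by (auto simp: not_less dest: le_Suc_ex)
          have "prv L \<Delta>' (subst (\<lambda>_. Var (Suc j + length [a, b])) (num_fm I ((c # cs) ! Suc j)))"
            by (rule prv_rename_num[OF num sub']) (use i j in simp)
          then show ?thesis using j by simp
        qed
      next
        have "prv L \<Delta>' (subst ?\<tau> (And (pair_cond m \<theta>) \<phi>))"
        proof -
          have "prv L \<Delta>' (rename (\<lambda>v. v + 2) \<phi>)"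
            using prv_mono[OF prv_subst[OF \<phi>\<Delta>, of "\<lambda>v. Var (v + 2)"]] sub' by simp
          also have "rename (\<lambda>v. v + 2) \<phi> = subst ?\<tau> \<phi>"
            using \<phi>(2) by (intro subst_cong) auto
          finally have 1: "prv L \<Delta>' (subst ?\<tau> \<phi>)" .
          \<comment> \<open>The witnesses send \<open>x\<^sub>0\<close>, \<open>x\<^sub>1\<close>,
            \<open>z\<^sub>0\<close> to variables 0, 1, 2, undoing the renaming of
            \<open>\<theta>\<close>.\<close>
          have "subst ?\<tau> (rename (\<lambda>v. if v = 0 then Suc m else if v = 1 then Suc (Suc m) else 0) \<theta>) = \<theta>"
            unfolding subst_subst using \<theta>(2) by (intro subst_id) auto
          then have 2: "prv L \<Delta>' (subst ?\<tau> (pair_cond m \<theta>))"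
            using \<theta>\<Delta>' cs unfolding pair_cond_def by (auto intro!: prv.Refl)
          from 1 2 show ?thesis by simp
        qed
        then show "prv L \<Delta>' (subst ?\<sigma> ?\<psi>)"
          unfolding pair_fm_def by (rule prv_subst_ExsI) simp
      qed simp
      then show "prv L \<Delta>' (rename (\<lambda>v. v + length [a, b]) ?\<chi>)"
        unfolding closed .
    qed
    then show "prv L \<Delta> (rename (\<lambda>v. v + length (c # cs)) ?\<chi>)"
      unfolding closed .
  qed
qed

end

section \<open>Computing the code of the contracted formula\<close>

definition imp_code :: "nat \<Rightarrow> nat \<Rightarrow> nat" where
  "imp_code x y = prod_encode (3, prod_encode (x, y))"

definition neg_code :: "nat \<Rightarrow> nat" where
  "neg_code x = imp_code x (code Bot)"

definition ex_code :: "nat \<Rightarrow> nat" where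
  "ex_code x = neg_code (prod_encode (4, neg_code x))"

lemma code_Exs_And:
  "code (Exs k (And \<chi> \<phi>)) = (ex_code ^^ k) (neg_code (imp_code (code \<chi>) (neg_code (code \<phi>))))"
  by (induction k) (simp_all add: imp_code_def neg_code_def ex_code_def)

lemma recursive_neg_code: "recursive k f \<Longrightarrow> recursive k (\<lambda>xs. neg_code (f xs))"
  unfolding neg_code_def imp_code_def by (intro recursive_prod_encode recursive_const)

text \<open>The number \<open>k\<close> of quantifiers and the code \<open>x\<close> are independent
  of the input, so induction on \<open>k\<close> outside the computation suffices.\<close>

lemma recursive_code_Exs_And:
  assumes "recursive j f"
  shows "recursive j (\<lambda>xs. (ex_code ^^ k) (neg_code (imp_code x (neg_code (f xs)))))"
proof (induction k)
  case 0
  show ?case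
    unfolding imp_code_def funpow_0
    by (intro recursive_prod_encode recursive_const recursive_neg_code assms)
next
  case (Suc k)
  then show ?case
    by (simp add: ex_code_def recursive_prod_encode recursive_const recursive_neg_code)
qed

section \<open>Transfer of the effective Rosser property\<close>

theorem theorem7p3:
  fixes L :: lang and T :: "fm set" and I :: transl and n :: nat
    and J\<^sub>2 :: "nat \<Rightarrow> nat \<Rightarrow> nat" and R :: "nat \<Rightarrow> nat \<Rightarrow> nat list set"
  assumes "pairing J\<^sub>2"
    and "acceptable R"
    and "is_theory L T" and "consistent L T" and "re_theory L T"
    and "n \<ge> 1"
    and "interprets_Num L T I"
    and "strongly_definable2 L T I J\<^sub>2"
    and "effectively_Rosser R n L T I"
  shows "effectively_Rosser R (n + 1) L T I"
proof -
  obtain m where n: "n = Suc m" using \<open>n \<ge> 1\<close> by (cases n) auto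
  have I: "is_transl num_lang L I"
    using \<open>interprets_Num L T I\<close> unfolding interpretation_of_def by blast
  obtain \<theta> where \<theta>: "wf_fm L \<theta>" "fv \<theta> \<subseteq> {0, 1, 2}"
    and def: "\<And>a b. prv L T (All (Iff (num_inst I [a, b] \<theta>)
      (num_inst I [J\<^sub>2 a b] (Eq (Var 1) (Var 0)))))"
    using \<open>strongly_definable2 L T I J\<^sub>2\<close> unfolding strongly_definable2_def by blast
  obtain f where f: "recursive 2 f"
    and sep: "\<And>i j. \<exists>\<phi>. f [i, j] = code \<phi> \<and> wf_fm L \<phi> \<and> fv \<phi> = {..<n} \<and>
      strongly_separates L T I \<phi> (R n i - R n j) (R n j - R n i)"
    using \<open>effectively_Rosser R n L T I\<close> unfolding effectively_Rosser_def by blast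
  obtain h where h: "recursive 1 (\<lambda>xs. h (xs ! 0))"
    and R: "\<And>i a b cs. length cs = n - 1 \<Longrightarrow>
      J\<^sub>2 a b # cs \<in> R n (h i) \<longleftrightarrow> a # b # cs \<in> R (Suc n) i"
    using acceptable_pairing[OF \<open>acceptable R\<close> \<open>pairing J\<^sub>2\<close> \<open>n \<ge> 1\<close>] by blast
  \<comment> \<open>By \<open>code_Exs_And\<close> this is the code of
    \<open>pair_fm m \<theta> \<phi>\<close> when the inner value of \<open>f\<close> is the code of
    \<open>\<phi>\<close>.\<close>
  define g where "g xs = (ex_code ^^ Suc m) (neg_code (imp_code (code (pair_cond m \<theta>))
    (neg_code (f [h (xs ! 0), h (xs ! 1)]))))" for xs
  show ?thesis
    unfolding effectively_Rosser_def
  proof (intro exI[of _ g] conjI allI)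
    have "recursive 2 (\<lambda>xs. h (xs ! 0))" "recursive 2 (\<lambda>xs. h (xs ! 1))"
      by (rule recursive_comp1[OF h], rule recursive_nth, simp)+
    then have "recursive 2 (\<lambda>xs. f [h (xs ! 0), h (xs ! 1)])"
      using recursive_comp[of "[\<lambda>xs. h (xs ! 0), \<lambda>xs. h (xs ! 1)]" f 2] f
      by (auto simp: numeral_2_eq_2)
    then show "recursive 2 g"
      unfolding g_def by (rule recursive_code_Exs_And)
  next
    fix i j
    obtain \<phi> where \<phi>: "f [h i, h j] = code \<phi>" "wf_fm L \<phi>" "fv \<phi> = {..<n}"
      and s: "strongly_separates L T I \<phi> (R n (h i) - R n (h j)) (R n (h j) - R n (h i))"
      using sep[of "h i" "h j"] by blast
    let ?\<psi> = "pair_fm m \<theta> \<phi>"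
    have fv: "fv \<phi> \<subseteq> {..<Suc m}" using \<phi>(3) n by simp
    have cases: "\<exists>a b cs. as = a # b # cs \<and> length cs = m" if "as \<in> R (n + 1) k" for as k
      using acceptable_length[OF \<open>acceptable R\<close> _ that] n by (auto simp: length_Suc_conv)
    have "prv L T (num_inst I as ?\<psi>)" if as_in: "as \<in> R (n + 1) i - R (n + 1) j" for as
    proof -
      obtain a b cs where as: "as = a # b # cs" "length cs = m"
        using cases as_in by blast
      \<comment> \<open>Pairing preserves membership in both directions, so differences of the
        relations correspond.\<close>
      then have "J\<^sub>2 a b # cs \<in> R n (h i) - R n (h j)"
        using as_in R n by simp
      then have "prv L T (num_inst I (J\<^sub>2 a b # cs) \<phi>)"
        using s unfolding strongly_separates_def by blast
      with prv_imp_pair_fm[OF \<open>is_theory L T\<close> I \<theta> def \<phi>(2) fv as(2)] show ?thesis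
        unfolding as by (rule prv.ImpE)
    qed
    moreover have "prv L T (Neg (num_inst I as ?\<psi>))" if as_in: "as \<in> R (n + 1) j - R (n + 1) i" for as
    proof -
      obtain a b cs where as: "as = a # b # cs" "length cs = m"
        using cases as_in by blast
      then have "J\<^sub>2 a b # cs \<in> R n (h j) - R n (h i)"
        using as_in R n by simp
      then have "prv L T (Neg (num_inst I (J\<^sub>2 a b # cs) \<phi>))"
        using s unfolding strongly_separates_def by blast
      \<comment> \<open>What has to be refuted is the instance itself, so the negative half is the
        contrapositive of the converse implication.\<close>
      with prv_pair_fm_imp[OF \<open>is_theory L T\<close> I \<theta> def \<phi>(2) fv as(2)] show ?thesis
        unfolding as by (rule prv_contrapos)
    qed
    ultimately have "strongly_separates L T I ?\<psi> (R (n + 1) i - R (n + 1) j)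
        (R (n + 1) j - R (n + 1) i)"
      unfolding strongly_separates_def by blast
    moreover have "g [i, j] = code ?\<psi>"
      unfolding pair_fm_def code_Exs_And g_def using \<phi>(1) by simp
    ultimately show "\<exists>\<phi>. g [i, j] = code \<phi> \<and> wf_fm L \<phi> \<and> fv \<phi> = {..<n + 1} \<and>
        strongly_separates L T I \<phi> (R (n + 1) i - R (n + 1) j) (R (n + 1) j - R (n + 1) i)"
      using wf_pair_fm[OF \<theta>(1) \<phi>(2)] fv_pair_fm[OF \<theta>(2) fv] n by auto
  qed
qed

end
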